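(* Let $M$ be a smooth manifold, let $h\ge 0$ and $k\geq 1$ be integers, let $L\subseteq \mathbf{T}_h^{big}M$ be an untwisted stable Dirac structure of index $h$ on $M$, and let $V_1,\dots,V_k$ be commuting vector fields on $M$ ($[V_p,V_q]=0$ for all $p,q$) that are infinitesimal automorphisms of $L$. For $x\in M$ put $$\hat L_x=\Big\{\big(X-w\cdot V(x),\,u,\,\alpha(V(x))\big)\oplus(\alpha,v,w)\ :\ (X,u)\oplus(\alpha,v)\in L_x,\ w\in\mathbb{R}^k\Big\},$$ where $w\cdot V=\sum_{p=1}^k w^pV_p$ and $\alpha(V)=(\alpha(V_1),\dots,\alpha(V_k))\in\mathbb{R}^k$. Then $\hat L=\bigcup_{x\in M}\hat L_x$ is an untwisted stable Dirac structure of index $h+k$ on $M$.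
   Context: All manifolds and maps are $C^\infty$. For an integer $h\ge0$, $\mathbf{T}_h^{big}M=(TM\times\mathbb{R}^h)\oplus(T^*M\times\mathbb{R}^h)$, a vector bundle over $M$ with elements written $(X,u)\oplus(\alpha,v)$, $X\in TM$, $\alpha\in T^*M$, $u,v\in\mathbb{R}^h$. It carries the neutral metric $$G((X_1,u_1)\oplus(\alpha_1,v_1),(X_2,u_2)\oplus(\alpha_2,v_2))=\tfrac12(\alpha_2(X_1)+\alpha_1(X_2)+u_1\cdot v_2+u_2\cdot v_1),$$ where the dot is the standard scalar product. Sections have $X$ a vector field, $\alpha$ a $1$-form, and $u,v:M\to\mathbb{R}^h$ smooth functions. The untwisted stable Courant bracket of index $h$ on sections is $$[(X_1,u_1)\oplus(\alpha_1,v_1),(X_2,u_2)\oplus(\alpha_2,v_2)]=([X_1,X_2],X_1u_2-X_2u_1)\oplus\Big(L_{X_1}\alpha_2-L_{X_2}\alpha_1+\tfrac12d(\alpha_1(X_2)-\alpha_2(X_1))+\tfrac12(u_2\cdot dv_1+v_2\cdot du_1-u_1\cdot dv_2-v_1\cdot du_2),\ X_1v_2-X_2v_1\Big).$$ An untwisted stable Dirac structure of index $h$ is a maximal $G$-isotropic (smooth) subbundle $L\subseteq\mathbf{T}_h^{big}M$ (so of rank $\dim M+h$) whose space of sections is closed under this bracket. A vector field $V$ on $M$ is an infinitesimal automorphism of $L$ if for every section $(X,u)\oplus(\alpha,v)\in\Gamma L$ one has $([V,X],Vu)\oplus(L_V\alpha,Vv)\in\Gamma L$. Elements of $\mathbf{T}^{big}_{h+k}M$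 are written $(X,u,u')\oplus(\alpha,v,v')$ with $u,v\in\mathbb{R}^h$, $u',v'\in\mathbb{R}^k$, using $\mathbb{R}^{h+k}=\mathbb{R}^h\times\mathbb{R}^k$. *)

theory Defs
  imports "HOL-Analysis.Analysis" "HOL-Library.Function_Algebras"
begin

section \<open>Pointwise vector space structure on functions\<close>

instantiation "fun" :: (type, real_vector) real_vector
begin

definition scaleR_fun :: "real \<Rightarrow> ('a \<Rightarrow> 'b) \<Rightarrow> 'a \<Rightarrow> 'b" where
  "scaleR_fun r f = (\<lambda>x. r *\<^sub>R f x)"

instance
  by standard (auto simp: scaleR_fun_def fun_eq_iff scaleR_add_right scaleR_add_left)

end


section \<open>Smooth maps on open sets\<close>

text \<open>
  Iterated directional derivatives. For open \<open>S\<close> in a finite-dimensional space,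
  \<open>Ck_on k S f\<close> says that \<open>f\<close> is of class \<open>C\<close>-\<open>k\<close> on \<open>S\<close>.
\<close>

primrec Ck_on :: "nat \<Rightarrow> 'a::real_normed_vector set \<Rightarrow> ('a \<Rightarrow> 'b::real_normed_vector) \<Rightarrow> bool" where
  "Ck_on 0 S f \<longleftrightarrow> continuous_on S f"
| "Ck_on (Suc k) S f \<longleftrightarrow>
     (\<forall>x\<in>S. f differentiable at x) \<and> (\<forall>v. Ck_on k S (\<lambda>x. frechet_derivative f (at x) v))"

definition smooth_on :: "'a::real_normed_vector set \<Rightarrow> ('a \<Rightarrow> 'b::real_normed_vector) \<Rightarrow> bool" where
  "smooth_on S f \<longleftrightarrow> (\<forall>k. Ck_on k S f)"


section \<open>Smooth manifolds\<close>

text \<open>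
  A manifold is a topological space with a smooth atlas, not necessarily maximal; all notions
  below only depend on the maximal atlas generated by it. The model space is a finite-dimensional
  inner product space rather than a member of class \<open>euclidean_space\<close>, because the latter
  excludes dimension 0. A chart is a pair of its domain and its coordinate map; the values of the
  coordinate map outside the domain are irrelevant.
\<close>

type_synonym ('m, 'e) chart = "'m set \<times> ('m \<Rightarrow> 'e)"

record ('m, 'e) manifold =
  space_of :: "'m topology"
  atlas :: "('m, 'e) chart set"

abbreviation points :: "('m, 'e) manifold \<Rightarrow> 'm set" where
  "points M \<equiv> topspace (space_of M)"

definition transition :: "('m, 'e) chart \<Rightarrow> ('m, 'e) chart \<Rightarrow> 'e \<Rightarrow> 'e" where
  "transition c c' = snd c' \<circ> inv_into (fst c) (snd c)"

definition smooth_manifold :: "('m, 'e::real_inner) manifold \<Rightarrow> bool" where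
  "smooth_manifold M \<longleftrightarrow>
     (\<exists>B :: 'e set. finite B \<and> span B = UNIV) \<and>
     Hausdorff_space (space_of M) \<and> second_countable (space_of M) \<and>
     (\<Union>c\<in>atlas M. fst c) = points M \<and>
     (\<forall>c\<in>atlas M. openin (space_of M) (fst c) \<and> open (snd c ` fst c) \<and>
        homeomorphic_map (subtopology (space_of M) (fst c)) (top_of_set (snd c ` fst c)) (snd c)) \<and>
     (\<forall>c\<in>atlas M. \<forall>c'\<in>atlas M. smooth_on (snd c ` (fst c \<inter> fst c')) (transition c c'))"

definition charts_at :: "('m, 'e) manifold \<Rightarrow> 'm \<Rightarrow> ('m, 'e) chart set" where
  "charts_at M x = {c \<in> atlas M. x \<in> fst c}"

definition in_chart :: "('m, 'e) chart \<Rightarrow> ('m \<Rightarrow> 'b) \<Rightarrow> 'e \<Rightarrow> 'b" where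
  "in_chart c f = f \<circ> inv_into (fst c) (snd c)"

text \<open>The derivative at \<open>x\<close>, in the coordinates of \<open>c\<close>, of \<open>f\<close> in the coordinate direction \<open>v\<close>.\<close>

definition chart_deriv ::
  "('m, 'e::real_normed_vector) chart \<Rightarrow> ('m \<Rightarrow> 'b::real_normed_vector) \<Rightarrow> 'm \<Rightarrow> 'e \<Rightarrow> 'b" where
  "chart_deriv c f x = frechet_derivative (in_chart c f) (at (snd c x))"

definition smooth_fun ::
  "('m, 'e::real_normed_vector) manifold \<Rightarrow> 'm set \<Rightarrow> ('m \<Rightarrow> 'b::real_normed_vector) \<Rightarrow> bool" where
  "smooth_fun M W f \<longleftrightarrow> (\<forall>c\<in>atlas M. smooth_on (snd c ` (fst c \<inter> W)) (in_chart c f))"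


section \<open>Tangent and cotangent vectors\<close>

text \<open>
  A tangent vector at \<open>x\<close> is a family of coordinate vectors, one for each chart around \<open>x\<close>,
  transforming by the derivatives of the transition maps. Dually, a cotangent vector is a family
  of linear forms on the model space; it acts on tangent vectors by \<open>pairing\<close>, which does not
  depend on the chart used to evaluate it. Families vanish on charts not around \<open>x\<close>.
\<close>

type_synonym ('m, 'e) tvec = "('m, 'e) chart \<Rightarrow> 'e"
type_synonym ('m, 'e) cotvec = "('m, 'e) chart \<Rightarrow> 'e \<Rightarrow>\<^sub>L real"

definition transition_deriv ::
  "('m, 'e::real_normed_vector) chart \<Rightarrow> ('m, 'e) chart \<Rightarrow> 'm \<Rightarrow> 'e \<Rightarrow> 'e" where
  "transition_deriv c c' x = frechet_derivative (transition c c') (at (snd c x))"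

definition tangent_space :: "('m, 'e::real_normed_vector) manifold \<Rightarrow> 'm \<Rightarrow> ('m, 'e) tvec set" where
  "tangent_space M x =
     {\<xi>. (\<forall>c. c \<notin> charts_at M x \<longrightarrow> \<xi> c = 0) \<and>
         (\<forall>c\<in>charts_at M x. \<forall>c'\<in>charts_at M x. \<xi> c' = transition_deriv c c' x (\<xi> c))}"

definition cotangent_space :: "('m, 'e::real_normed_vector) manifold \<Rightarrow> 'm \<Rightarrow> ('m, 'e) cotvec set" where
  "cotangent_space M x =
     {\<alpha>. (\<forall>c. c \<notin> charts_at M x \<longrightarrow> \<alpha> c = 0) \<and>
         (\<forall>c\<in>charts_at M x. \<forall>c'\<in>charts_at M x. \<forall>v.
            blinfun_apply (\<alpha> c) v = blinfun_apply (\<alpha> c') (transition_deriv c c' x v))}"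

definition chart_around :: "('m, 'e) manifold \<Rightarrow> 'm \<Rightarrow> ('m, 'e) chart" where
  "chart_around M x = (SOME c. c \<in> charts_at M x)"

definition pairing ::
  "('m, 'e::real_normed_vector) manifold \<Rightarrow> 'm \<Rightarrow> ('m, 'e) cotvec \<Rightarrow> ('m, 'e) tvec \<Rightarrow> real" where
  "pairing M x \<alpha> \<xi> = blinfun_apply (\<alpha> (chart_around M x)) (\<xi> (chart_around M x))"

definition vector_field_on ::
  "('m, 'e::real_normed_vector) manifold \<Rightarrow> 'm set \<Rightarrow> ('m \<Rightarrow> ('m, 'e) tvec) \<Rightarrow> bool" where
  "vector_field_on M W X \<longleftrightarrow>
     (\<forall>x\<in>W. X x \<in> tangent_space M x) \<and>
     (\<forall>c\<in>atlas M. smooth_on (snd c ` (fst c \<inter> W)) (in_chart c (\<lambda>x. X x c)))"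

definition one_form_on ::
  "('m, 'e::real_normed_vector) manifold \<Rightarrow> 'm set \<Rightarrow> ('m \<Rightarrow> ('m, 'e) cotvec) \<Rightarrow> bool" where
  "one_form_on M W \<alpha> \<longleftrightarrow>
     (\<forall>x\<in>W. \<alpha> x \<in> cotangent_space M x) \<and>
     (\<forall>c\<in>atlas M. smooth_on (snd c ` (fst c \<inter> W)) (in_chart c (\<lambda>x. \<alpha> x c)))"

abbreviation vector_field :: "('m, 'e::real_normed_vector) manifold \<Rightarrow> ('m \<Rightarrow> ('m, 'e) tvec) \<Rightarrow> bool" where
  "vector_field M X \<equiv> vector_field_on M (points M) X"

text \<open>
  The Lie bracket and Lie derivative are given by their coordinate expressions
  \<open>[X,Y] = DY(X) - DX(Y)\<close> and \<open>L_X \<alpha> = D\<alpha>(X) + \<alpha> \<circ> DX\<close> in every chart, that is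
  \<open>[X,Y]^i = X^j \<partial>_j Y^i - Y^j \<partial>_j X^i\<close> and \<open>(L_X \<alpha>)_i = X^j \<partial>_j \<alpha>_i + \<alpha>_j \<partial>_i X^j\<close>.
\<close>

definition vf_apply ::
  "('m, 'e::real_normed_vector) manifold \<Rightarrow> ('m \<Rightarrow> ('m, 'e) tvec) \<Rightarrow> ('m \<Rightarrow> real) \<Rightarrow> 'm \<Rightarrow> real" where
  "vf_apply M X f x = chart_deriv (chart_around M x) f x (X x (chart_around M x))"

definition differential ::
  "('m, 'e::real_normed_vector) manifold \<Rightarrow> ('m \<Rightarrow> real) \<Rightarrow> 'm \<Rightarrow> ('m, 'e) cotvec" where
  "differential M f x = (\<lambda>c. if c \<in> charts_at M x then Blinfun (chart_deriv c f x) else 0)"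

definition lie_bracket ::
  "('m, 'e::real_normed_vector) manifold \<Rightarrow> ('m \<Rightarrow> ('m, 'e) tvec) \<Rightarrow> ('m \<Rightarrow> ('m, 'e) tvec) \<Rightarrow>
   'm \<Rightarrow> ('m, 'e) tvec" where
  "lie_bracket M X Y x =
     (\<lambda>c. if c \<in> charts_at M x
          then chart_deriv c (\<lambda>y. Y y c) x (X x c) - chart_deriv c (\<lambda>y. X y c) x (Y x c)
          else 0)"

definition lie_deriv ::
  "('m, 'e::real_normed_vector) manifold \<Rightarrow> ('m \<Rightarrow> ('m, 'e) tvec) \<Rightarrow> ('m \<Rightarrow> ('m, 'e) cotvec) \<Rightarrow>
   'm \<Rightarrow> ('m, 'e) cotvec" where
  "lie_deriv M X \<alpha> x =
     (\<lambda>c. if c \<in> charts_at M x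
          then chart_deriv c (\<lambda>y. \<alpha> y c) x (X x c) +
               Blinfun (\<lambda>v. blinfun_apply (\<alpha> x c) (chart_deriv c (\<lambda>y. X y c) x v))
          else 0)"


section \<open>The stable big tangent bundle\<close>

text \<open>
  \<open>\<real>\<close>-to-the-\<open>h\<close>, for \<open>h\<close> a natural number possibly 0, is the space of sequences vanishing from
  index \<open>h\<close> on. The element \<open>(X,u) \<oplus> (\<alpha>,v)\<close> is encoded as \<open>((X,u),(\<alpha>,v))\<close>.
\<close>

definition Rvec :: "nat \<Rightarrow> (nat \<Rightarrow> real) set" where
  "Rvec h = {u. \<forall>i\<ge>h. u i = 0}"

text \<open>The identification of \<open>(u,u')\<close>, where \<open>u\<close> has \<open>h\<close> components, with a single vector.\<close>

definition vappend :: "nat \<Rightarrow> (nat \<Rightarrow> real) \<Rightarrow> (nat \<Rightarrow> real) \<Rightarrow> nat \<Rightarrow> real" where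
  "vappend h u u' = (\<lambda>i. if i < h then u i else u' (i - h))"

type_synonym ('m, 'e) big = "(('m, 'e) tvec \<times> (nat \<Rightarrow> real)) \<times> (('m, 'e) cotvec \<times> (nat \<Rightarrow> real))"

abbreviation tan_part :: "('m, 'e::real_normed_vector) big \<Rightarrow> ('m, 'e) tvec" where
  "tan_part a \<equiv> fst (fst a)"
abbreviation u_part :: "('m, 'e::real_normed_vector) big \<Rightarrow> nat \<Rightarrow> real" where
  "u_part a \<equiv> snd (fst a)"
abbreviation cot_part :: "('m, 'e::real_normed_vector) big \<Rightarrow> ('m, 'e) cotvec" where
  "cot_part a \<equiv> fst (snd a)"
abbreviation v_part :: "('m, 'e::real_normed_vector) big \<Rightarrow> nat \<Rightarrow> real" where
  "v_part a \<equiv> snd (snd a)"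

definition big_fibre :: "('m, 'e::real_normed_vector) manifold \<Rightarrow> nat \<Rightarrow> 'm \<Rightarrow> ('m, 'e) big set" where
  "big_fibre M h x = (tangent_space M x \<times> Rvec h) \<times> (cotangent_space M x \<times> Rvec h)"

definition G_metric ::
  "('m, 'e::real_normed_vector) manifold \<Rightarrow> nat \<Rightarrow> 'm \<Rightarrow> ('m, 'e) big \<Rightarrow> ('m, 'e) big \<Rightarrow> real" where
  "G_metric M h x a b =
     1/2 * (pairing M x (cot_part b) (tan_part a) + pairing M x (cot_part a) (tan_part b) +
            (\<Sum>i<h. u_part a i * v_part b i) + (\<Sum>i<h. u_part b i * v_part a i))"

definition big_section_on ::
  "('m, 'e::real_normed_vector) manifold \<Rightarrow> nat \<Rightarrow> 'm set \<Rightarrow> ('m \<Rightarrow> ('m, 'e) big) \<Rightarrow> bool" where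
  "big_section_on M h W s \<longleftrightarrow>
     (\<forall>x\<in>W. s x \<in> big_fibre M h x) \<and>
     vector_field_on M W (\<lambda>x. tan_part (s x)) \<and>
     one_form_on M W (\<lambda>x. cot_part (s x)) \<and>
     (\<forall>i<h. smooth_fun M W (\<lambda>x. u_part (s x) i) \<and> smooth_fun M W (\<lambda>x. v_part (s x) i))"

definition stable_courant_bracket ::
  "('m, 'e::real_normed_vector) manifold \<Rightarrow> nat \<Rightarrow> ('m \<Rightarrow> ('m, 'e) big) \<Rightarrow> ('m \<Rightarrow> ('m, 'e) big) \<Rightarrow>
   'm \<Rightarrow> ('m, 'e) big" where
  "stable_courant_bracket M h s1 s2 x =
     (let X1 = (\<lambda>y. tan_part (s1 y)); u1 = (\<lambda>i y. u_part (s1 y) i);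
          \<alpha>1 = (\<lambda>y. cot_part (s1 y)); v1 = (\<lambda>i y. v_part (s1 y) i);
          X2 = (\<lambda>y. tan_part (s2 y)); u2 = (\<lambda>i y. u_part (s2 y) i);
          \<alpha>2 = (\<lambda>y. cot_part (s2 y)); v2 = (\<lambda>i y. v_part (s2 y) i)
      in ((lie_bracket M X1 X2 x,
           \<lambda>i. vf_apply M X1 (u2 i) x - vf_apply M X2 (u1 i) x),
          (lie_deriv M X1 \<alpha>2 x - lie_deriv M X2 \<alpha>1 x
           + (1/2) *\<^sub>R differential M (\<lambda>y. pairing M y (\<alpha>1 y) (X2 y) - pairing M y (\<alpha>2 y) (X1 y)) x
           + (1/2) *\<^sub>R (\<Sum>i<h. u2 i x *\<^sub>R differential M (v1 i) x + v2 i x *\<^sub>R differential M (u1 i) x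
                           - u1 i x *\<^sub>R differential M (v2 i) x - v1 i x *\<^sub>R differential M (u2 i) x),
           \<lambda>i. vf_apply M X1 (v2 i) x - vf_apply M X2 (v1 i) x)))"


section \<open>Stable Dirac structures\<close>

text \<open>
  A subbundle is given by the family of its fibres; smoothness means that it is locally spanned
  by a smooth frame.
\<close>

definition smooth_subbundle ::
  "('m, 'e::real_normed_vector) manifold \<Rightarrow> nat \<Rightarrow> nat \<Rightarrow> ('m \<Rightarrow> ('m, 'e) big set) \<Rightarrow> bool" where
  "smooth_subbundle M h r L \<longleftrightarrow>
     (\<forall>x\<in>points M. subspace (L x) \<and> L x \<subseteq> big_fibre M h x) \<and>
     (\<forall>x\<in>points M. \<exists>W e. openin (space_of M) W \<and> x \<in> W \<and>
        (\<forall>i<r. big_section_on M h W (e i)) \<and>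
        (\<forall>y\<in>W. inj_on (\<lambda>i. e i y) {..<r} \<and> independent ((\<lambda>i. e i y) ` {..<r}) \<and>
                span ((\<lambda>i. e i y) ` {..<r}) = L y))"

definition isotropic :: "('m, 'e::real_normed_vector) manifold \<Rightarrow> nat \<Rightarrow> 'm \<Rightarrow> ('m, 'e) big set \<Rightarrow> bool" where
  "isotropic M h x S \<longleftrightarrow> (\<forall>a\<in>S. \<forall>b\<in>S. G_metric M h x a b = 0)"

definition maximal_isotropic ::
  "('m, 'e::real_normed_vector) manifold \<Rightarrow> nat \<Rightarrow> 'm \<Rightarrow> ('m, 'e) big set \<Rightarrow> bool" where
  "maximal_isotropic M h x S \<longleftrightarrow>
     subspace S \<and> S \<subseteq> big_fibre M h x \<and> isotropic M h x S \<and>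
     (\<forall>S'. subspace S' \<and> S' \<subseteq> big_fibre M h x \<and> isotropic M h x S' \<and> S \<subseteq> S' \<longrightarrow> S' = S)"

definition sections_of ::
  "('m, 'e::real_normed_vector) manifold \<Rightarrow> nat \<Rightarrow> ('m \<Rightarrow> ('m, 'e) big set) \<Rightarrow> ('m \<Rightarrow> ('m, 'e) big) set" where
  "sections_of M h L = {s. big_section_on M h (points M) s \<and> (\<forall>x\<in>points M. s x \<in> L x)}"

text \<open>
  Maximality is that of each fibre among the isotropic subspaces. As \<open>G\<close> is neutral, it
  forces the rank to be \<open>dim M + h\<close>.
\<close>

definition stable_dirac ::
  "('m, 'e::real_inner) manifold \<Rightarrow> nat \<Rightarrow> ('m \<Rightarrow> ('m, 'e) big set) \<Rightarrow> bool" where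
  "stable_dirac M h L \<longleftrightarrow>
     smooth_subbundle M h (dim (UNIV :: 'e set) + h) L \<and>
     (\<forall>x\<in>points M. maximal_isotropic M h x (L x)) \<and>
     (\<forall>s1\<in>sections_of M h L. \<forall>s2\<in>sections_of M h L.
        stable_courant_bracket M h s1 s2 \<in> sections_of M h L)"

definition infinitesimal_automorphism ::
  "('m, 'e::real_normed_vector) manifold \<Rightarrow> nat \<Rightarrow> ('m \<Rightarrow> ('m, 'e) big set) \<Rightarrow>
   ('m \<Rightarrow> ('m, 'e) tvec) \<Rightarrow> bool" where
  "infinitesimal_automorphism M h L V \<longleftrightarrow>
     vector_field M V \<and>
     (\<forall>s\<in>sections_of M h L.
        (\<lambda>x. ((lie_bracket M V (\<lambda>y. tan_part (s y)) x, \<lambda>i. vf_apply M V (\<lambda>y. u_part (s y) i) x),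
              (lie_deriv M V (\<lambda>y. cot_part (s y)) x, \<lambda>i. vf_apply M V (\<lambda>y. v_part (s y) i) x)))
        \<in> sections_of M h L)"

definition stable_extension ::
  "('m, 'e::real_normed_vector) manifold \<Rightarrow> nat \<Rightarrow> nat \<Rightarrow> (nat \<Rightarrow> 'm \<Rightarrow> ('m, 'e) tvec) \<Rightarrow>
   ('m \<Rightarrow> ('m, 'e) big set) \<Rightarrow> 'm \<Rightarrow> ('m, 'e) big set" where
  "stable_extension M h k V L x =
     {((\<xi> - (\<Sum>p<k. w p *\<^sub>R V p x),
        vappend h u (\<lambda>p. if p < k then pairing M x \<alpha> (V p x) else 0)),
       (\<alpha>, vappend h v w)) | \<xi> u \<alpha> v w. ((\<xi>, u), (\<alpha>, v)) \<in> L x \<and> w \<in> Rvec k}"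

end

(* Every section of the extended bundle is T(s,w) for a unique global section s of L and smooth
   functions w = (w^1,...,w^k), where T(s,w) = (X - w.V, u, alpha(V)) + (alpha, v, w). The map T
   preserves G, and pairing with T(0,e_p) recovers the components alpha(V_p), so maximality of L_x
   passes to the extension. Closure under the bracket comes from
     [T(s1,w1), T(s2,w2)] = T(s3,w3),
     s3 = [s1,s2] + sum_p (w2^p L_{V_p} s1 - w1^p L_{V_p} s2),
     w3 = (X1 - w1.V) w2 - (X2 - w2.V) w1.
   Commutativity of the V_p enters in the vector field and alpha(V) components; the latter also
   needs G(L_{V_p} s1, s2) = G(s1, L_{V_p} s2), both sides being 0 as L is isotropic and
   V_p-invariant. *)
theory Submission
  imports Defs
begin

section \<open>Calculus of smooth maps\<close>

text \<open>Origin of T: a section (X,u) + (\<alpha>,v) is a translation-invariant section X +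
  u.d/dt + \<alpha> + v.dt of the big tangent bundle of M x R^h, and the stable bracket is the
  Courant bracket there. With coordinates s on R^k, T applies to X + u.d/dt + \<alpha> + v.dt + w.ds
  the transformation by the bivector field sum_p V_p wedge d/ds^p, which sends \<alpha> + w.ds to
  \<alpha>(V).d/ds - w.V. Skewness of this map makes T an isometry of G, and the bivector field is
  Poisson because the V_p commute. Two obstacles shape the proof. Closure and invariance are
  conditions on global sections, so they cannot be tested on local frames; s and w have to be read
  off globally, by explicit formulas. Moreover, the pairing and the action of a vector field on
  functions use a chart chosen separately at each point, so every claim on smoothness or derivatives
  first passes to one fixed chart.\<close>

lemma frechet_derivative_cong_open:
  assumes "open S" "x \<in> S" "\<And>y. y \<in> S \<Longrightarrow> f y = g y"
  shows "frechet_derivative f (at x) = frechet_derivative g (at x)"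
    and "f differentiable at x \<longleftrightarrow> g differentiable at x"
proof -
  have "(f has_derivative D) (at x) \<longleftrightarrow> (g has_derivative D) (at x)" for D
    using has_derivative_transform_within_open[OF _ assms(1,2), where f = f and g = g]
      has_derivative_transform_within_open[OF _ assms(1,2), where f = g and g = f] assms(3) by auto
  then show "frechet_derivative f (at x) = frechet_derivative g (at x)"
    and "f differentiable at x \<longleftrightarrow> g differentiable at x"
    by (simp_all add: frechet_derivative_def differentiable_def)
qed

lemma Ck_on_cong:
  assumes "open S" "Ck_on k S f" "\<And>x. x \<in> S \<Longrightarrow> f x = g x"
  shows "Ck_on k S g"
  using assms(2,3)
proof (induction k arbitrary: f g)
  case 0
  then show ?case using continuous_on_cong[of S S f g] by simp
next
  case (Suc k)
  note eq = frechet_derivative_cong_open[OF assms(1) _ Suc.prems(2)]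
  have "Ck_on k S (\<lambda>x. frechet_derivative g (at x) v)" for v
    by (rule Suc.IH[of "\<lambda>x. frechet_derivative f (at x) v"]) (use Suc.prems(1) eq(1) in simp_all)
  then show ?case
    using Suc.prems(1) eq(2) by simp
qed

lemma Ck_on_SucD: "Ck_on (Suc k) S f \<Longrightarrow> Ck_on k S f"
proof (induction k arbitrary: f)
  case 0
  then show ?case
    by (auto intro!: continuous_at_imp_continuous_on differentiable_imp_continuous_within)
next
  case (Suc k)
  then show ?case unfolding Ck_on.simps(2)[of "Suc k"] Ck_on.simps(2)[of k S f] by blast
qed

text \<open>\<open>Ck_on\<close> is phrased with \<open>frechet_derivative\<close>, which is a
  choice. Uniqueness of the derivative lets any explicit derivative \<open>D\<close> stand in for it
  on the open set \<open>S\<close>, so each closure property needs only a differentiation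
  rule.\<close>

lemma Ck_on_Suc_derivI:
  assumes "open S" "\<And>x. x \<in> S \<Longrightarrow> (f has_derivative D x) (at x)"
    and "\<And>v. Ck_on k S (\<lambda>x. D x v)"
  shows "Ck_on (Suc k) S f"
proof -
  have "D x = frechet_derivative f (at x)" if "x \<in> S" for x
    using assms(2)[OF that] by (rule frechet_derivative_at)
  then have "Ck_on k S (\<lambda>x. frechet_derivative f (at x) v)" for v
    by (intro Ck_on_cong[OF assms(1) assms(3)[of v]]) simp
  then show ?thesis
    using assms(2) by (auto simp: differentiable_def)
qed

lemma Ck_on_Suc_has_derivative:
  "Ck_on (Suc k) S f \<Longrightarrow> x \<in> S \<Longrightarrow> (f has_derivative frechet_derivative f (at x)) (at x)"
  by (simp flip: frechet_derivative_works)

lemma Ck_on_const: "open S \<Longrightarrow> Ck_on k S (\<lambda>x. c)"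
proof (induction k arbitrary: c)
  case (Suc k)
  then show ?case
    by (intro Ck_on_Suc_derivI[where D = "\<lambda>_ _. 0"]) simp_all
qed simp

lemma Ck_on_add:
  assumes "open S" "Ck_on k S f" "Ck_on k S g"
  shows "Ck_on k S (\<lambda>x. f x + g x)"
  using assms(2,3)
proof (induction k arbitrary: f g)
  case 0
  then show ?case by (auto intro: continuous_on_add)
next
  case (Suc k)
  show ?case
  proof (rule Ck_on_Suc_derivI[OF assms(1)])
    show "((\<lambda>x. f x + g x) has_derivative
        (\<lambda>v. frechet_derivative f (at x) v + frechet_derivative g (at x) v)) (at x)"
      if "x \<in> S" for x
      using that Suc.prems by (intro has_derivative_add Ck_on_Suc_has_derivative[of k S])
    show "Ck_on k S (\<lambda>x. frechet_derivative f (at x) v + frechet_derivative g (at x) v)" for v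
      using Suc.prems by (intro Suc.IH) auto
  qed
qed

text \<open>Each Leibniz term is again a value of the same bilinear map, so the induction closes
  with both factors varying; the undifferentiated factor drops one degree by
  \<open>Ck_on_SucD\<close>. Products, scalar multiples, inner products and evaluation of linear
  forms are instances.\<close>

lemma (in bounded_bilinear) Ck_on:
  assumes "open S" "Ck_on k S f" "Ck_on k S g"
  shows "Ck_on k S (\<lambda>x. prod (f x) (g x))"
  using assms(2,3)
proof (induction k arbitrary: f g)
  case 0
  then show ?case by (auto intro: continuous_on)
next
  case (Suc k)
  show ?case
  proof (rule Ck_on_Suc_derivI[OF assms(1)])
    show "((\<lambda>x. prod (f x) (g x)) has_derivative
        (\<lambda>v. prod (f x) (frechet_derivative g (at x) v) + prod (frechet_derivative f (at x) v) (g x))) (at x)"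
      if "x \<in> S" for x
      using that Suc.prems by (intro FDERIV Ck_on_Suc_has_derivative[of k S])
    show "Ck_on k S (\<lambda>x. prod (f x) (frechet_derivative g (at x) v) + prod (frechet_derivative f (at x) v) (g x))" for v
      using Suc.prems by (intro Ck_on_add[OF assms(1)] Suc.IH Ck_on_SucD[of k S f] Ck_on_SucD[of k S g]) auto
  qed
qed

lemma smooth_on_cong:
  assumes "open S" "smooth_on S f" "\<And>x. x \<in> S \<Longrightarrow> f x = g x"
  shows "smooth_on S g"
  unfolding smooth_on_def
proof
  fix k
  show "Ck_on k S g"
    by (rule Ck_on_cong[OF assms(1) _ assms(3)]) (use assms(2) in \<open>auto simp: smooth_on_def\<close>)
qed

lemma smooth_on_const: "open S \<Longrightarrow> smooth_on S (\<lambda>x. c)"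
  by (simp add: smooth_on_def Ck_on_const)

lemma smooth_on_add: "open S \<Longrightarrow> smooth_on S f \<Longrightarrow> smooth_on S g \<Longrightarrow> smooth_on S (\<lambda>x. f x + g x)"
  by (simp add: smooth_on_def Ck_on_add)

lemma (in bounded_bilinear) smooth_on:
  "open S \<Longrightarrow> smooth_on S f \<Longrightarrow> smooth_on S g \<Longrightarrow> smooth_on S (\<lambda>x. prod (f x) (g x))"
  by (simp add: smooth_on_def Ck_on)

lemma smooth_on_sum:
  "open S \<Longrightarrow> (\<And>i. i \<in> I \<Longrightarrow> smooth_on S (f i)) \<Longrightarrow> smooth_on S (\<lambda>x. \<Sum>i\<in>I. f i x)"
  by (induction I rule: infinite_finite_induct) (auto intro: smooth_on_add smooth_on_const)

lemma smooth_on_differentiable: "smooth_on S f \<Longrightarrow> x \<in> S \<Longrightarrow> f differentiable at x"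
  unfolding smooth_on_def using Ck_on.simps(2) by blast

lemma smooth_on_directional_derivative:
  "smooth_on S f \<Longrightarrow> smooth_on S (\<lambda>x. frechet_derivative f (at x) v)"
  unfolding smooth_on_def using Ck_on.simps(2) by blast

section \<open>Derivatives along a direction that varies with the point\<close>

text \<open>The model space comes only with a finite spanning set; Gram-Schmidt turns it into an
  expansion whose coefficients are smooth in \<open>v\<close>. \<open>C\<close> may contain 0, whose
  term vanishes anyway.\<close>

lemma orthogonal_basis_expansion:
  assumes "finite B" "span B = (UNIV :: 'e::real_inner set)"
  shows "\<exists>C. finite C \<and> (\<forall>v :: 'e. v = (\<Sum>b\<in>C. (inner v b / inner b b) *\<^sub>R b))"
proof -
  obtain C where C: "finite C" "span C = span B" "pairwise orthogonal C"
    using basis_orthogonal[OF assms(1)] by metis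
  have "v = (\<Sum>b\<in>C. (inner v b / inner b b) *\<^sub>R b)" for v
  proof -
    let ?r = "v - (\<Sum>b\<in>C. (inner v b / inner b b) *\<^sub>R b)"
    have "inner a ?r = 0" if "a \<in> C" for a
    proof -
      have "(\<Sum>b\<in>C. (inner v b / inner b b) * inner a b) = (\<Sum>b\<in>C. if b = a then inner v a else 0)"
        using C(3) that by (intro sum.cong) (auto simp: pairwise_def orthogonal_def)
      then show ?thesis
        using C(1) that by (simp add: inner_diff_right inner_sum_right inner_commute)
    qed
    \<comment> \<open>The remainder is orthogonal to \<open>C\<close>, hence to the whole space,
      hence to itself.\<close>
    then have "orthogonal ?r a" if "a \<in> span C" for a
      using orthogonal_to_span[OF that, of ?r] by (simp add: orthogonal_def inner_commute)
    then have "orthogonal ?r ?r"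
      using C(2) assms(2) by blast
    then show ?thesis by (simp add: orthogonal_def)
  qed
  with C(1) show ?thesis by blast
qed

text \<open>\<open>Ck_on\<close> controls derivatives in a fixed direction only. Expanding the
  varying direction \<open>X z\<close> gives a finite sum of smooth coefficients times such
  derivatives.\<close>

lemma smooth_on_derivative_apply:
  fixes f :: "'e::real_inner \<Rightarrow> 'b::real_normed_vector"
  assumes "finite B" "span B = (UNIV :: 'e set)" "open S" "smooth_on S f" "smooth_on S X"
  shows "smooth_on S (\<lambda>z. frechet_derivative f (at z) (X z))"
proof -
  obtain C where C: "finite C" "\<And>v :: 'e. v = (\<Sum>b\<in>C. (inner v b / inner b b) *\<^sub>R b)"
    using orthogonal_basis_expansion[OF assms(1,2)] by blast
  \<comment> \<open>Division is written as multiplication by the constant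
    \<open>1 / inner b b\<close>, so that smoothness follows from bilinearity, whether or not
    \<open>b\<close> is 0.\<close>
  have "smooth_on S (\<lambda>z. \<Sum>b\<in>C. (inner (X z) b * (1 / inner b b)) *\<^sub>R frechet_derivative f (at z) b)"
    using assms(3-5)
    by (intro smooth_on_sum bounded_bilinear.smooth_on[OF bounded_bilinear_scaleR]
        bounded_bilinear.smooth_on[OF bounded_bilinear_mult]
        bounded_bilinear.smooth_on[OF bounded_bilinear_inner] smooth_on_const
        smooth_on_directional_derivative)
  then show ?thesis
  proof (rule smooth_on_cong[OF assms(3)])
    fix z assume "z \<in> S"
    then have lin: "linear (frechet_derivative f (at z))"
      using assms(4) smooth_on_differentiable linear_frechet_derivative by blast
    have "frechet_derivative f (at z) (X z)
        = frechet_derivative f (at z) (\<Sum>b\<in>C. (inner (X z) b / inner b b) *\<^sub>R b)"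
      using C(2)[of "X z"] by simp
    then show "(\<Sum>b\<in>C. (inner (X z) b * (1 / inner b b)) *\<^sub>R frechet_derivative f (at z) b)
        = frechet_derivative f (at z) (X z)"
      by (simp add: linear_sum[OF lin] linear_cmul[OF lin])
  qed
qed

section \<open>Charts\<close>

locale smooth_mfd =
  fixes M :: "('m, 'e::real_inner) manifold"
  assumes smooth_manifold: "smooth_manifold M"
begin

lemma finite_basis: "\<exists>B :: 'e set. finite B \<and> span B = UNIV"
  using smooth_manifold by (simp add: smooth_manifold_def)

lemma chart_homeomorphic:
  "c \<in> atlas M \<Longrightarrow> homeomorphic_map (subtopology (space_of M) (fst c)) (top_of_set (snd c ` fst c)) (snd c)"
  "c \<in> atlas M \<Longrightarrow> openin (space_of M) (fst c)"
  "c \<in> atlas M \<Longrightarrow> open (snd c ` fst c)"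
  using smooth_manifold by (auto simp: smooth_manifold_def)

lemma chart_domain_subset: "c \<in> atlas M \<Longrightarrow> fst c \<subseteq> points M"
  using chart_homeomorphic(2) openin_subset by blast

lemma chart_around_in: "x \<in> points M \<Longrightarrow> chart_around M x \<in> charts_at M x"
proof -
  assume "x \<in> points M"
  moreover have "(\<Union>c\<in>atlas M. fst c) = points M"
    using smooth_manifold by (simp add: smooth_manifold_def)
  ultimately obtain c where "c \<in> charts_at M x"
    unfolding charts_at_def by blast
  then show ?thesis
    unfolding chart_around_def by (rule someI)
qed

lemma charts_atD: "c \<in> charts_at M x \<Longrightarrow> c \<in> atlas M \<and> x \<in> fst c"
  by (simp add: charts_at_def)

lemma charts_at_points: "c \<in> charts_at M x \<Longrightarrow> x \<in> points M"
  using charts_atD chart_domain_subset by blast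

lemma chart_inj_on: "c \<in> atlas M \<Longrightarrow> inj_on (snd c) (fst c)"
  using homeomorphic_imp_injective_map[OF chart_homeomorphic(1)] chart_domain_subset
  by (metis inf.absorb_iff2 topspace_subtopology)

lemma in_chart_snd: "c \<in> atlas M \<Longrightarrow> x \<in> fst c \<Longrightarrow> in_chart c f (snd c x) = f x"
  by (simp add: in_chart_def chart_inj_on)

lemma chart_image_open:
  assumes "c \<in> atlas M" "openin (space_of M) W"
  shows "open (snd c ` (fst c \<inter> W))"
proof -
  have "openin (subtopology (space_of M) (fst c)) (fst c \<inter> W)"
    using assms(2) by (simp add: openin_subtopology_Int2)
  then have "openin (top_of_set (snd c ` fst c)) (snd c ` (fst c \<inter> W))"
    using homeomorphic_imp_open_map[OF chart_homeomorphic(1)[OF assms(1)]] by (simp add: open_map_def)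
  then show ?thesis
    using chart_homeomorphic(3)[OF assms(1)] openin_open_eq by blast
qed

lemma transition_differentiable:
  assumes "c \<in> charts_at M x" "c' \<in> charts_at M x"
  shows "transition c c' differentiable at (snd c x)"
  using smooth_manifold assms
  by (intro smooth_on_differentiable[of "snd c ` (fst c \<inter> fst c')"])
    (auto simp: smooth_manifold_def charts_at_def)

lemma transition_deriv_linear:
  "c \<in> charts_at M x \<Longrightarrow> c' \<in> charts_at M x \<Longrightarrow> linear (transition_deriv c c' x)"
  unfolding transition_deriv_def using transition_differentiable by (rule linear_frechet_derivative)

text \<open>On the overlap of the charts \<open>in_chart c f\<close> is \<open>in_chart c' f\<close>
  composed with the transition map, so this is the chain rule. It makes \<open>vf_apply\<close>
  independent of the chart that it picks.\<close>

lemma chart_deriv_transition: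
  assumes c: "c \<in> charts_at M x" "c' \<in> charts_at M x"
    and f: "in_chart c' f differentiable at (snd c' x)"
  shows "chart_deriv c f x v = chart_deriv c' f x (transition_deriv c c' x v)"
proof -
  note cD = charts_atD[OF c(1)] charts_atD[OF c(2)]
  let ?S = "snd c ` (fst c \<inter> fst c')"
  have S: "open ?S" "snd c x \<in> ?S"
    using chart_image_open[of c "fst c'"] chart_homeomorphic(2) cD by auto
  have tx: "transition c c' (snd c x) = snd c' x"
    using cD by (simp add: transition_def chart_inj_on)
  have "(transition c c' has_derivative transition_deriv c c' x) (at (snd c x))"
    unfolding transition_deriv_def
    using transition_differentiable[OF c] frechet_derivative_works by blast
  moreover have "(in_chart c' f has_derivative chart_deriv c' f x) (at (transition c c' (snd c x)))"
    unfolding chart_deriv_def tx using f frechet_derivative_works by blast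
  ultimately have "((in_chart c' f \<circ> transition c c') has_derivative
      (chart_deriv c' f x \<circ> transition_deriv c c' x)) (at (snd c x))"
    by (rule diff_chain_at)
  then have "(in_chart c f has_derivative (chart_deriv c' f x \<circ> transition_deriv c c' x)) (at (snd c x))"
    by (rule has_derivative_transform_within_open[OF _ S])
      (use cD in \<open>auto simp: in_chart_snd transition_def chart_inj_on\<close>)
  then show ?thesis
    using frechet_derivative_at unfolding chart_deriv_def by (metis comp_apply)
qed

end

lemma Ck_on_subset: "Ck_on k S f \<Longrightarrow> T \<subseteq> S \<Longrightarrow> Ck_on k T f"
proof (induction k arbitrary: f)
  case 0
  then show ?case by (auto elim: continuous_on_subset)
qed auto

lemma smooth_on_subset: "smooth_on S f \<Longrightarrow> T \<subseteq> S \<Longrightarrow> smooth_on T f"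
  unfolding smooth_on_def by (metis Ck_on_subset)

lemma sum_fun_apply: "(\<Sum>i\<in>I. f i) c = (\<Sum>i\<in>I. f i c)"
  by (induction I rule: infinite_finite_induct) auto

lemma scaleR_fun_apply: "(r *\<^sub>R f) c = r *\<^sub>R f c"
  by (simp add: scaleR_fun_def)

lemma subspace_Rvec: "subspace (Rvec k)"
  by (auto simp: subspace_def Rvec_def scaleR_fun_apply)

context smooth_mfd
begin

section \<open>Smooth functions, vector fields and one-forms\<close>

lemma smooth_in_chart_cong:
  assumes "c \<in> atlas M" "openin (space_of M) W"
    and "smooth_on (snd c ` (fst c \<inter> W)) (in_chart c f)" "\<And>x. x \<in> W \<Longrightarrow> f x = g x"
  shows "smooth_on (snd c ` (fst c \<inter> W)) (in_chart c g)"
  by (rule smooth_on_cong[OF chart_image_open[OF assms(1,2)] assms(3)])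
    (use assms(4) in \<open>auto simp: in_chart_snd[OF assms(1)]\<close>)

lemma smooth_fun_cong:
  "openin (space_of M) W \<Longrightarrow> smooth_fun M W f \<Longrightarrow> (\<And>x. x \<in> W \<Longrightarrow> f x = g x) \<Longrightarrow> smooth_fun M W g"
  unfolding smooth_fun_def by (simp add: smooth_in_chart_cong[of _ W f g])

lemma smooth_fun_const: "openin (space_of M) W \<Longrightarrow> smooth_fun M W (\<lambda>x. a)"
  by (simp add: smooth_fun_def in_chart_def o_def smooth_on_const chart_image_open)

lemma smooth_fun_add:
  "openin (space_of M) W \<Longrightarrow> smooth_fun M W f \<Longrightarrow> smooth_fun M W g \<Longrightarrow> smooth_fun M W (\<lambda>x. f x + g x)"
  by (simp add: smooth_fun_def in_chart_def o_def smooth_on_add chart_image_open)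

lemma smooth_fun_mult:
  "openin (space_of M) W \<Longrightarrow> smooth_fun M W f \<Longrightarrow> smooth_fun M W g \<Longrightarrow>
    smooth_fun M W (\<lambda>x. f x * g x :: real)"
  by (simp add: smooth_fun_def in_chart_def o_def chart_image_open
      bounded_bilinear.smooth_on[OF bounded_bilinear_mult])

lemma smooth_fun_diff:
  fixes f g :: "'m \<Rightarrow> real"
  assumes "openin (space_of M) W" "smooth_fun M W f" "smooth_fun M W g"
  shows "smooth_fun M W (\<lambda>x. f x - g x)"
proof -
  have "smooth_fun M W (\<lambda>x. f x + (-1) * g x)"
    by (intro smooth_fun_add smooth_fun_mult smooth_fun_const assms)
  then show ?thesis by simp
qed

lemma smooth_fun_sum:
  "openin (space_of M) W \<Longrightarrow> (\<And>i. i \<in> I \<Longrightarrow> smooth_fun M W (f i)) \<Longrightarrow>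
    smooth_fun M W (\<lambda>x. \<Sum>i\<in>I. f i x)"
  by (induction I rule: infinite_finite_induct) (simp_all add: smooth_fun_const smooth_fun_add)

lemma tangent_space_transition:
  "\<xi> \<in> tangent_space M x \<Longrightarrow> c \<in> charts_at M x \<Longrightarrow> c' \<in> charts_at M x \<Longrightarrow>
    \<xi> c' = transition_deriv c c' x (\<xi> c)"
  unfolding tangent_space_def by blast

lemma cotangent_space_transition:
  "\<alpha> \<in> cotangent_space M x \<Longrightarrow> c \<in> charts_at M x \<Longrightarrow> c' \<in> charts_at M x \<Longrightarrow>
    blinfun_apply (\<alpha> c) v = blinfun_apply (\<alpha> c') (transition_deriv c c' x v)"
  unfolding cotangent_space_def by blast

lemma tangent_space_outside: "\<xi> \<in> tangent_space M x \<Longrightarrow> c \<notin> charts_at M x \<Longrightarrow> \<xi> c = 0"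
  unfolding tangent_space_def by blast

lemma cotangent_space_outside: "\<alpha> \<in> cotangent_space M x \<Longrightarrow> c \<notin> charts_at M x \<Longrightarrow> \<alpha> c = 0"
  unfolding cotangent_space_def by blast

lemma tangent_spaceI:
  assumes "\<And>c. c \<notin> charts_at M x \<Longrightarrow> \<xi> c = 0"
    and "\<And>c c'. c \<in> charts_at M x \<Longrightarrow> c' \<in> charts_at M x \<Longrightarrow> \<xi> c' = transition_deriv c c' x (\<xi> c)"
  shows "\<xi> \<in> tangent_space M x"
  unfolding tangent_space_def using assms by blast

lemma cotangent_spaceI:
  assumes "\<And>c. c \<notin> charts_at M x \<Longrightarrow> \<alpha> c = 0"
    and "\<And>c c' v. c \<in> charts_at M x \<Longrightarrow> c' \<in> charts_at M x \<Longrightarrow>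
      blinfun_apply (\<alpha> c) v = blinfun_apply (\<alpha> c') (transition_deriv c c' x v)"
  shows "\<alpha> \<in> cotangent_space M x"
  unfolding cotangent_space_def using assms by blast

lemma subspace_tangent_space: "subspace (tangent_space M x)"
  unfolding subspace_def
proof (intro conjI ballI allI)
  show "0 \<in> tangent_space M x"
    by (rule tangent_spaceI) (simp_all add: linear_0[OF transition_deriv_linear])
next
  fix \<xi> \<eta> assume *: "\<xi> \<in> tangent_space M x" "\<eta> \<in> tangent_space M x"
  show "\<xi> + \<eta> \<in> tangent_space M x"
  proof (rule tangent_spaceI)
    fix c c' assume c: "c \<in> charts_at M x" "c' \<in> charts_at M x"
    show "(\<xi> + \<eta>) c' = transition_deriv c c' x ((\<xi> + \<eta>) c)"
      unfolding plus_fun_apply linear_add[OF transition_deriv_linear[OF c]]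
      using *[THEN tangent_space_transition, OF c] by (simp only:)
  qed (simp add: *[THEN tangent_space_outside])
next
  fix r \<xi> assume *: "\<xi> \<in> tangent_space M x"
  show "r *\<^sub>R \<xi> \<in> tangent_space M x"
  proof (rule tangent_spaceI)
    fix c c' assume c: "c \<in> charts_at M x" "c' \<in> charts_at M x"
    show "(r *\<^sub>R \<xi>) c' = transition_deriv c c' x ((r *\<^sub>R \<xi>) c)"
      unfolding scaleR_fun_apply linear_cmul[OF transition_deriv_linear[OF c]]
      using *[THEN tangent_space_transition, OF c] by (simp only:)
  qed (simp add: *[THEN tangent_space_outside] scaleR_fun_apply)
qed

lemma subspace_cotangent_space: "subspace (cotangent_space M x)"
  unfolding subspace_def
proof (intro conjI ballI allI)
  show "0 \<in> cotangent_space M x"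
    by (rule cotangent_spaceI) simp_all
next
  fix \<alpha> \<beta> assume *: "\<alpha> \<in> cotangent_space M x" "\<beta> \<in> cotangent_space M x"
  show "\<alpha> + \<beta> \<in> cotangent_space M x"
  proof (rule cotangent_spaceI)
    fix c c' v assume c: "c \<in> charts_at M x" "c' \<in> charts_at M x"
    show "blinfun_apply ((\<alpha> + \<beta>) c) v = blinfun_apply ((\<alpha> + \<beta>) c') (transition_deriv c c' x v)"
      unfolding plus_fun_apply blinfun.add_left
      using *[THEN cotangent_space_transition, OF c, of v] by (simp only:)
  qed (simp add: *[THEN cotangent_space_outside])
next
  fix r \<alpha> assume *: "\<alpha> \<in> cotangent_space M x"
  show "r *\<^sub>R \<alpha> \<in> cotangent_space M x"
  proof (rule cotangent_spaceI)
    fix c c' v assume c: "c \<in> charts_at M x" "c' \<in> charts_at M x"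
    show "blinfun_apply ((r *\<^sub>R \<alpha>) c) v = blinfun_apply ((r *\<^sub>R \<alpha>) c') (transition_deriv c c' x v)"
      unfolding scaleR_fun_apply blinfun.scaleR_left
      using *[THEN cotangent_space_transition, OF c, of v] by (simp only:)
  qed (simp add: *[THEN cotangent_space_outside] scaleR_fun_apply)
qed

lemma subspace_big_fibre: "subspace (big_fibre M h x)"
  unfolding big_fibre_def
  by (intro subspace_Times subspace_tangent_space subspace_cotangent_space subspace_Rvec)

lemma vector_field_on_add:
  "openin (space_of M) W \<Longrightarrow> vector_field_on M W X \<Longrightarrow> vector_field_on M W Y \<Longrightarrow>
    vector_field_on M W (\<lambda>x. X x + Y x)"
  by (simp add: vector_field_on_def in_chart_def o_def smooth_on_add chart_image_open
      subspace_add[OF subspace_tangent_space])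

lemma vector_field_on_scaleR:
  "openin (space_of M) W \<Longrightarrow> smooth_fun M W f \<Longrightarrow> vector_field_on M W X \<Longrightarrow>
    vector_field_on M W (\<lambda>x. f x *\<^sub>R X x)"
  by (simp add: vector_field_on_def smooth_fun_def in_chart_def o_def chart_image_open scaleR_fun_apply
      bounded_bilinear.smooth_on[OF bounded_bilinear_scaleR] subspace_scale[OF subspace_tangent_space])

lemma vector_field_on_zero: "openin (space_of M) W \<Longrightarrow> vector_field_on M W (\<lambda>x. 0)"
  by (simp add: vector_field_on_def in_chart_def o_def chart_image_open smooth_on_const
      subspace_0[OF subspace_tangent_space])

lemma vector_field_on_sum:
  "openin (space_of M) W \<Longrightarrow> (\<And>i. i \<in> I \<Longrightarrow> vector_field_on M W (X i)) \<Longrightarrow>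
    vector_field_on M W (\<lambda>x. \<Sum>i\<in>I. X i x)"
  by (induction I rule: infinite_finite_induct) (simp_all add: vector_field_on_zero vector_field_on_add)

lemma vector_field_on_uminus:
  assumes "openin (space_of M) W" "vector_field_on M W X"
  shows "vector_field_on M W (\<lambda>x. - X x)"
  using vector_field_on_scaleR[OF assms(1) smooth_fun_const[OF assms(1), of "-1"] assms(2)] by simp

lemma vector_field_on_diff:
  assumes "openin (space_of M) W" "vector_field_on M W X" "vector_field_on M W Y"
  shows "vector_field_on M W (\<lambda>x. X x - Y x)"
  using vector_field_on_add[OF assms(1,2) vector_field_on_uminus[OF assms(1,3)]] by simp

lemma vector_field_on_subset:
  "vector_field_on M W X \<Longrightarrow> W' \<subseteq> W \<Longrightarrow> vector_field_on M W' X"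
  unfolding vector_field_on_def
  by (intro conjI ballI smooth_on_subset[of "snd _ ` (fst _ \<inter> W)" _ "snd _ ` (fst _ \<inter> W')"]) auto

lemma one_form_on_add:
  "openin (space_of M) W \<Longrightarrow> one_form_on M W \<alpha> \<Longrightarrow> one_form_on M W \<beta> \<Longrightarrow>
    one_form_on M W (\<lambda>x. \<alpha> x + \<beta> x)"
  by (simp add: one_form_on_def in_chart_def o_def smooth_on_add chart_image_open
      subspace_add[OF subspace_cotangent_space])

lemma one_form_on_scaleR:
  "openin (space_of M) W \<Longrightarrow> smooth_fun M W f \<Longrightarrow> one_form_on M W \<alpha> \<Longrightarrow>
    one_form_on M W (\<lambda>x. f x *\<^sub>R \<alpha> x)"
  by (simp add: one_form_on_def smooth_fun_def in_chart_def o_def chart_image_open scaleR_fun_apply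
      bounded_bilinear.smooth_on[OF bounded_bilinear_scaleR] subspace_scale[OF subspace_cotangent_space])

lemma one_form_on_zero: "openin (space_of M) W \<Longrightarrow> one_form_on M W (\<lambda>x. 0)"
  by (simp add: one_form_on_def in_chart_def o_def chart_image_open smooth_on_const
      subspace_0[OF subspace_cotangent_space])

section \<open>The pairing of one-forms with vector fields\<close>

lemma pairing_chart:
  assumes "c \<in> charts_at M x" "\<alpha> \<in> cotangent_space M x" "\<xi> \<in> tangent_space M x"
  shows "pairing M x \<alpha> \<xi> = blinfun_apply (\<alpha> c) (\<xi> c)"
proof -
  have "chart_around M x \<in> charts_at M x"
    using assms(1) charts_at_points chart_around_in by blast
  then show ?thesis
    using cotangent_space_transition[OF assms(2) _ assms(1)]
      tangent_space_transition[OF assms(3) _ assms(1)]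
    unfolding pairing_def by metis
qed

text \<open>The chart used by \<open>pairing\<close> may jump from point to point, so smoothness is
  proved for the evaluation in one fixed chart, which agrees with the pairing on its domain.\<close>

lemma smooth_fun_pairing:
  assumes W: "openin (space_of M) W" and "one_form_on M W \<alpha>" "vector_field_on M W X"
  shows "smooth_fun M W (\<lambda>x. pairing M x (\<alpha> x) (X x))"
  unfolding smooth_fun_def
proof
  fix c assume c: "c \<in> atlas M"
  have "smooth_on (snd c ` (fst c \<inter> W)) (in_chart c (\<lambda>x. blinfun_apply (\<alpha> x c) (X x c)))"
    using bounded_bilinear.smooth_on[OF bounded_bilinear_blinfun_apply chart_image_open[OF c W],
        of "in_chart c (\<lambda>x. \<alpha> x c)" "in_chart c (\<lambda>x. X x c)"] assms(2,3) c
    by (simp add: one_form_on_def vector_field_on_def in_chart_def o_def)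
  then show "smooth_on (snd c ` (fst c \<inter> W)) (in_chart c (\<lambda>x. pairing M x (\<alpha> x) (X x)))"
  proof (rule smooth_on_cong[OF chart_image_open[OF c W]])
    fix z assume "z \<in> snd c ` (fst c \<inter> W)"
    then obtain x where x: "x \<in> fst c" "x \<in> W" "z = snd c x" by blast
    then have "pairing M x (\<alpha> x) (X x) = blinfun_apply (\<alpha> x c) (X x c)"
      using assms c by (intro pairing_chart) (auto simp: charts_at_def one_form_on_def vector_field_on_def)
    then show "in_chart c (\<lambda>x. blinfun_apply (\<alpha> x c) (X x c)) z
        = in_chart c (\<lambda>x. pairing M x (\<alpha> x) (X x)) z"
      using x c by (simp add: in_chart_snd)
  qed
qed

section \<open>Differentiation in a chart\<close>

abbreviation smooth_function :: "('m \<Rightarrow> real) \<Rightarrow> bool" where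
  "smooth_function \<equiv> smooth_fun M (points M)"

abbreviation one_form :: "('m \<Rightarrow> ('m, 'e) cotvec) \<Rightarrow> bool" where
  "one_form \<equiv> one_form_on M (points M)"

definition differentiable_in :: "('m, 'e) chart \<Rightarrow> ('m \<Rightarrow> 'b::real_normed_vector) \<Rightarrow> 'm \<Rightarrow> bool" where
  "differentiable_in c f x \<longleftrightarrow> in_chart c f differentiable at (snd c x)"

lemma has_chart_deriv:
  "differentiable_in c f x \<Longrightarrow> (in_chart c f has_derivative chart_deriv c f x) (at (snd c x))"
  unfolding differentiable_in_def chart_deriv_def by (simp flip: frechet_derivative_works)

lemma chart_derivI:
  assumes "(in_chart c f has_derivative D) (at (snd c x))"
  shows "differentiable_in c f x" "chart_deriv c f x = D"
  unfolding differentiable_in_def chart_deriv_def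
  using assms frechet_derivative_at[OF assms] by (auto simp: differentiable_def)

lemma bounded_linear_chart_deriv: "differentiable_in c f x \<Longrightarrow> bounded_linear (chart_deriv c f x)"
  using has_chart_deriv has_derivative_bounded_linear by blast

lemmas linear_chart_deriv = bounded_linear.linear[OF bounded_linear_chart_deriv]

lemma differentiable_in_smooth:
  assumes "c \<in> charts_at M x" "smooth_on (snd c ` (fst c \<inter> points M)) (in_chart c f)"
  shows "differentiable_in c f x"
  unfolding differentiable_in_def
  using assms charts_atD[OF assms(1)] charts_at_points[OF assms(1)]
  by (intro smooth_on_differentiable[OF assms(2)]) auto

lemma differentiable_in_smooth_fun:
  "c \<in> charts_at M x \<Longrightarrow> smooth_fun M (points M) f \<Longrightarrow> differentiable_in c f x"
  by (rule differentiable_in_smooth) (auto dest: charts_atD simp: smooth_fun_def)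

lemma differentiable_in_vector_field:
  "c \<in> charts_at M x \<Longrightarrow> vector_field M X \<Longrightarrow> differentiable_in c (\<lambda>y. X y c) x"
  by (rule differentiable_in_smooth) (auto dest: charts_atD simp: vector_field_on_def)

lemma differentiable_in_one_form:
  "c \<in> charts_at M x \<Longrightarrow> one_form \<alpha> \<Longrightarrow> differentiable_in c (\<lambda>y. \<alpha> y c) x"
  by (rule differentiable_in_smooth) (auto dest: charts_atD simp: one_form_on_def)

lemma chart_deriv_cong:
  assumes "c \<in> charts_at M x" "\<And>y. y \<in> fst c \<Longrightarrow> f y = g y"
  shows "chart_deriv c f x = chart_deriv c g x"
  unfolding chart_deriv_def
  by (rule frechet_derivative_cong_open(1)[where S = "snd c ` fst c"])
    (use charts_atD[OF assms(1)] assms(2) chart_homeomorphic(3) in \<open>auto simp: in_chart_snd\<close>)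

lemma chart_deriv_diff:
  assumes "differentiable_in c f x" "differentiable_in c g x"
  shows "differentiable_in c (\<lambda>y. f y - g y) x"
    and "chart_deriv c (\<lambda>y. f y - g y) x = (\<lambda>v. chart_deriv c f x v - chart_deriv c g x v)"
  using chart_derivI[of c "\<lambda>y. f y - g y"] has_derivative_diff[OF assms[THEN has_chart_deriv]]
  by (simp_all add: in_chart_def o_def)

lemma chart_deriv_sum:
  assumes "\<And>i. i \<in> I \<Longrightarrow> differentiable_in c (f i) x"
  shows "differentiable_in c (\<lambda>y. \<Sum>i\<in>I. f i y) x"
    and "chart_deriv c (\<lambda>y. \<Sum>i\<in>I. f i y) x = (\<lambda>v. \<Sum>i\<in>I. chart_deriv c (f i) x v)"
  using chart_derivI[of c "\<lambda>y. \<Sum>i\<in>I. f i y"]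
    has_derivative_sum[of I "\<lambda>i. in_chart c (f i)", OF has_chart_deriv[OF assms]]
  by (simp_all add: in_chart_def o_def)

lemma chart_deriv_bilinear:
  assumes "bounded_bilinear B" "c \<in> charts_at M x"
    and "differentiable_in c f x" "differentiable_in c g x"
  shows "differentiable_in c (\<lambda>y. B (f y) (g y)) x"
    and "chart_deriv c (\<lambda>y. B (f y) (g y)) x
      = (\<lambda>v. B (f x) (chart_deriv c g x v) + B (chart_deriv c f x v) (g x))"
  using chart_derivI[of c "\<lambda>y. B (f y) (g y)"] charts_atD[OF assms(2)]
    bounded_bilinear.FDERIV[OF assms(1) assms(3,4)[THEN has_chart_deriv]]
  by (simp_all add: in_chart_def o_def chart_inj_on)

lemmas chart_deriv_mult = chart_deriv_bilinear[OF bounded_bilinear_mult]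
lemmas chart_deriv_scaleR = chart_deriv_bilinear[OF bounded_bilinear_scaleR]
lemmas chart_deriv_blinfun_apply = chart_deriv_bilinear[OF bounded_bilinear_blinfun_apply]

lemma vf_apply_chart:
  assumes "c \<in> charts_at M x" "X x \<in> tangent_space M x" "smooth_function f"
  shows "vf_apply M X f x = chart_deriv c f x (X x c)"
proof -
  have c': "chart_around M x \<in> charts_at M x"
    using assms(1) charts_at_points chart_around_in by blast
  then have "X x c = transition_deriv (chart_around M x) c x (X x (chart_around M x))"
    using tangent_space_transition[OF assms(2) _ assms(1)] by blast
  then show ?thesis
    unfolding vf_apply_def
    using chart_deriv_transition[OF c' assms(1)] differentiable_in_smooth_fun[OF assms(1,3)]
    by (simp add: differentiable_in_def)
qed

text \<open>As for \<open>pairing\<close>, one fixed chart replaces the chosen ones. There the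
  direction \<open>X\<close> varies with the point, the case treated by
  \<open>smooth_on_derivative_apply\<close>.\<close>

lemma smooth_fun_vf_apply:
  assumes X: "vector_field M X" and f: "smooth_function f"
  shows "smooth_function (vf_apply M X f)"
  unfolding smooth_fun_def
proof
  fix c assume c: "c \<in> atlas M"
  let ?S = "snd c ` (fst c \<inter> points M)"
  have S: "open ?S"
    by (rule chart_image_open[OF c]) simp
  obtain B :: "'e set" where B: "finite B" "span B = UNIV"
    using finite_basis by blast
  have "smooth_on ?S (\<lambda>z. frechet_derivative (in_chart c f) (at z) (in_chart c (\<lambda>x. X x c) z))"
    using X f c by (intro smooth_on_derivative_apply[OF B S])
      (auto simp: smooth_fun_def vector_field_on_def)
  then show "smooth_on ?S (in_chart c (vf_apply M X f))"
  proof (rule smooth_on_cong[OF S])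
    fix z assume "z \<in> ?S"
    then obtain x where x: "x \<in> fst c" "x \<in> points M" "z = snd c x" by blast
    then have "vf_apply M X f x = chart_deriv c f x (X x c)"
      using X f c by (intro vf_apply_chart) (auto simp: vector_field_on_def charts_at_def)
    then show "frechet_derivative (in_chart c f) (at z) (in_chart c (\<lambda>x. X x c) z)
        = in_chart c (vf_apply M X f) z"
      using x c by (simp add: in_chart_snd chart_deriv_def)
  qed
qed


section \<open>Cartan calculus\<close>

lemma pairing_linear:
  "pairing M x (\<alpha> + \<beta>) \<xi> = pairing M x \<alpha> \<xi> + pairing M x \<beta> \<xi>"
  "pairing M x (\<alpha> - \<beta>) \<xi> = pairing M x \<alpha> \<xi> - pairing M x \<beta> \<xi>"
  "pairing M x (r *\<^sub>R \<alpha>) \<xi> = r * pairing M x \<alpha> \<xi>"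
  "pairing M x (\<Sum>i\<in>I. A i) \<xi> = (\<Sum>i\<in>I. pairing M x (A i) \<xi>)"
  "pairing M x 0 \<xi> = 0"
  "pairing M x \<alpha> (\<xi> + \<eta>) = pairing M x \<alpha> \<xi> + pairing M x \<alpha> \<eta>"
  "pairing M x \<alpha> (\<xi> - \<eta>) = pairing M x \<alpha> \<xi> - pairing M x \<alpha> \<eta>"
  "pairing M x \<alpha> (- \<xi>) = - pairing M x \<alpha> \<xi>"
  "pairing M x \<alpha> (r *\<^sub>R \<xi>) = r * pairing M x \<alpha> \<xi>"
  "pairing M x \<alpha> (\<Sum>i\<in>I. Z i) = (\<Sum>i\<in>I. pairing M x \<alpha> (Z i))"
  "pairing M x \<alpha> 0 = 0"
  by (simp_all add: pairing_def scaleR_fun_apply sum_fun_apply blinfun.add_left blinfun.diff_left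
      blinfun.scaleR_left blinfun.sum_left blinfun.add_right blinfun.diff_right
      blinfun.minus_right blinfun.scaleR_right blinfun.sum_right)

lemma vector_fieldD: "vector_field M X \<Longrightarrow> x \<in> points M \<Longrightarrow> X x \<in> tangent_space M x"
  by (simp add: vector_field_on_def)

lemma one_formD: "one_form \<alpha> \<Longrightarrow> x \<in> points M \<Longrightarrow> \<alpha> x \<in> cotangent_space M x"
  by (simp add: one_form_on_def)

text \<open>\<open>X\<close> minus a combination of the \<open>Z p\<close> is the shape X - w.V of
  the tangent part of T(s,w). The further lemmas on a \<open>combination\<close> are the Leibniz
  rules for this shape.\<close>

lemma vector_field_combination:
  assumes "vector_field M X" "\<And>p. p < k \<Longrightarrow> smooth_function (f p)" "\<And>p. p < k \<Longrightarrow> vector_field M (Z p)"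
  shows "vector_field M (\<lambda>y. X y - (\<Sum>p<k. f p y *\<^sub>R Z p y))"
  using assms by (intro vector_field_on_diff vector_field_on_sum vector_field_on_scaleR) auto

lemma chart_deriv_combination:
  assumes c: "c \<in> charts_at M x"
    and "vector_field M X" "\<And>p. p < k \<Longrightarrow> smooth_function (f p)" "\<And>p. p < k \<Longrightarrow> vector_field M (Z p)"
  shows "chart_deriv c (\<lambda>y. X y c - (\<Sum>p<k. f p y *\<^sub>R Z p y c)) x = (\<lambda>v. chart_deriv c (\<lambda>y. X y c) x v
    - (\<Sum>p<k. f p x *\<^sub>R chart_deriv c (\<lambda>y. Z p y c) x v + chart_deriv c (f p) x v *\<^sub>R Z p x c))"
proof -
  note d = differentiable_in_vector_field[OF c] differentiable_in_smooth_fun[OF c]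
  have Z: "differentiable_in c (\<lambda>y. f p y *\<^sub>R Z p y c) x"
    "chart_deriv c (\<lambda>y. f p y *\<^sub>R Z p y c) x
      = (\<lambda>v. f p x *\<^sub>R chart_deriv c (\<lambda>y. Z p y c) x v + chart_deriv c (f p) x v *\<^sub>R Z p x c)"
    if "p \<in> {..<k}" for p
    using that assms(3,4) chart_deriv_scaleR[OF c d(2) d(1), of "f p" "Z p"] by simp_all
  note S = chart_deriv_sum[of "{..<k}" c "\<lambda>p y. f p y *\<^sub>R Z p y c" x, OF Z(1)]
  have "chart_deriv c (\<lambda>y. X y c - (\<Sum>p<k. f p y *\<^sub>R Z p y c)) x = (\<lambda>v. chart_deriv c (\<lambda>y. X y c) x v
    - (\<Sum>p<k. chart_deriv c (\<lambda>y. f p y *\<^sub>R Z p y c) x v))"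
    using chart_deriv_diff(2)[OF d(1)[OF assms(2)] S(1)] S(2) by simp
  then show ?thesis
    by (simp add: sum_fun_apply scaleR_fun_apply Z(2))
qed

lemma lie_bracket_skew: "lie_bracket M X Y x = - lie_bracket M Y X x"
  by (simp add: lie_bracket_def fun_eq_iff)

lemma vf_apply_combination:
  assumes "x \<in> points M" "smooth_function g"
  shows "vf_apply M (\<lambda>y. X y - (\<Sum>p<k. f p y *\<^sub>R Z p y)) g x
    = vf_apply M X g x - (\<Sum>p<k. f p x * vf_apply M (Z p) g x)"
  using linear_chart_deriv[OF differentiable_in_smooth_fun[OF chart_around_in[OF assms(1)] assms(2)]]
  by (simp add: vf_apply_def linear_diff linear_sum linear_cmul sum_fun_apply scaleR_fun_apply)

text \<open>Only the second slot is treated; with \<open>lie_bracket_skew\<close> the same rule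
  serves for the first slot of [X1 - w1.V, X2 - w2.V].\<close>

lemma lie_bracket_combination_right:
  assumes x: "x \<in> points M" and X: "vector_field M X" and Y: "vector_field M Y"
    and f: "\<And>p. p < k \<Longrightarrow> smooth_function (f p)" and Z: "\<And>p. p < k \<Longrightarrow> vector_field M (Z p)"
  shows "lie_bracket M X (\<lambda>y. Y y - (\<Sum>p<k. f p y *\<^sub>R Z p y)) x = lie_bracket M X Y x
    - (\<Sum>p<k. f p x *\<^sub>R lie_bracket M X (Z p) x + vf_apply M X (f p) x *\<^sub>R Z p x)"
proof
  fix c
  show "lie_bracket M X (\<lambda>y. Y y - (\<Sum>p<k. f p y *\<^sub>R Z p y)) x c = (lie_bracket M X Y x
    - (\<Sum>p<k. f p x *\<^sub>R lie_bracket M X (Z p) x + vf_apply M X (f p) x *\<^sub>R Z p x)) c"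
  proof (cases "c \<in> charts_at M x")
    case True
    have *: "vf_apply M X (f p) x = chart_deriv c (f p) x (X x c)" if "p < k" for p
      by (rule vf_apply_chart[where X = X, OF True vector_fieldD[OF X x] f[OF that]])
    have "(\<Sum>p<k. f p x *\<^sub>R lie_bracket M X (Z p) x c + vf_apply M X (f p) x *\<^sub>R Z p x c) =
      (\<Sum>p<k. f p x *\<^sub>R (chart_deriv c (\<lambda>y. Z p y c) x (X x c) - chart_deriv c (\<lambda>y. X y c) x (Z p x c))
        + chart_deriv c (f p) x (X x c) *\<^sub>R Z p x c)"
      using True * by (intro sum.cong) (simp_all add: lie_bracket_def)
    then show ?thesis
      using True linear_chart_deriv[OF differentiable_in_vector_field[OF True X]]
      by (simp add: chart_deriv_combination[OF True Y f Z] lie_bracket_def sum_fun_apply scaleR_fun_apply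
          linear_diff linear_sum linear_cmul sum.distrib sum_subtractf scaleR_diff_right algebra_simps)
  next
    case False
    \<comment> \<open>Both sides vanish on a chart that is not around \<open>x\<close>: the brackets
      by their default value, \<open>Z p x\<close> because it is a tangent vector.\<close>
    then show ?thesis
      using tangent_space_outside[OF vector_fieldD[OF Z x] False]
      by (simp add: lie_bracket_def sum_fun_apply scaleR_fun_apply)
  qed
qed

text \<open>\<open>Blinfun\<close> is meaningful on bounded linear maps only; smoothness of
  \<open>X\<close> enters because it bounds the derivative of \<open>X\<close> in the chart.\<close>

lemma lie_deriv_chart:
  assumes "c \<in> charts_at M x" "vector_field M X"
  shows "blinfun_apply (lie_deriv M X \<alpha> x c) v
    = blinfun_apply (chart_deriv c (\<lambda>y. \<alpha> y c) x (X x c)) v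
      + blinfun_apply (\<alpha> x c) (chart_deriv c (\<lambda>y. X y c) x v)"
  using assms bounded_linear_chart_deriv[OF differentiable_in_vector_field[OF assms]]
  by (simp add: lie_deriv_def blinfun.add_left bounded_linear_Blinfun_apply
      bounded_linear_compose[OF blinfun.bounded_linear_right])

lemma differential_chart:
  assumes "c \<in> charts_at M x" "smooth_function f"
  shows "blinfun_apply (differential M f x c) v = chart_deriv c f x v"
  using assms bounded_linear_chart_deriv[OF differentiable_in_smooth_fun[OF assms]]
  by (simp add: differential_def bounded_linear_Blinfun_apply)

text \<open>\<open>lie_deriv\<close> contains \<alpha> composed with the derivative of the field,
  and differentiating the coefficients \<open>f p\<close> there leaves an extra term. This is the
  rule L_{fZ} \<alpha> = f L_Z \<alpha> + \<alpha>(Z) df.\<close>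

lemma lie_deriv_combination:
  assumes x: "x \<in> points M" and X: "vector_field M X" and \<alpha>: "one_form \<alpha>"
    and f: "\<And>p. p < k \<Longrightarrow> smooth_function (f p)" and Z: "\<And>p. p < k \<Longrightarrow> vector_field M (Z p)"
  shows "lie_deriv M (\<lambda>y. X y - (\<Sum>p<k. f p y *\<^sub>R Z p y)) \<alpha> x = lie_deriv M X \<alpha> x
    - (\<Sum>p<k. f p x *\<^sub>R lie_deriv M (Z p) \<alpha> x
        + pairing M x (\<alpha> x) (Z p x) *\<^sub>R differential M (f p) x)"
proof
  fix c
  show "lie_deriv M (\<lambda>y. X y - (\<Sum>p<k. f p y *\<^sub>R Z p y)) \<alpha> x c = (lie_deriv M X \<alpha> x
    - (\<Sum>p<k. f p x *\<^sub>R lie_deriv M (Z p) \<alpha> x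
        + pairing M x (\<alpha> x) (Z p x) *\<^sub>R differential M (f p) x)) c"
  proof (cases "c \<in> charts_at M x")
    case True
    show ?thesis
    proof (rule blinfun_eqI)
      fix v
      have "(\<Sum>p<k. f p x * blinfun_apply (lie_deriv M (Z p) \<alpha> x c) v
          + pairing M x (\<alpha> x) (Z p x) * blinfun_apply (differential M (f p) x c) v)
        = (\<Sum>p<k. f p x * (blinfun_apply (chart_deriv c (\<lambda>y. \<alpha> y c) x (Z p x c)) v
            + blinfun_apply (\<alpha> x c) (chart_deriv c (\<lambda>y. Z p y c) x v))
          + blinfun_apply (\<alpha> x c) (Z p x c) * chart_deriv c (f p) x v)"
        using pairing_chart[OF True one_formD[OF \<alpha> x] vector_fieldD[OF Z x]] f Z
        by (intro sum.cong) (simp_all add: lie_deriv_chart[OF True] differential_chart[OF True])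
      then show "blinfun_apply (lie_deriv M (\<lambda>y. X y - (\<Sum>p<k. f p y *\<^sub>R Z p y)) \<alpha> x c) v
        = blinfun_apply ((lie_deriv M X \<alpha> x - (\<Sum>p<k. f p x *\<^sub>R lie_deriv M (Z p) \<alpha> x
          + pairing M x (\<alpha> x) (Z p x) *\<^sub>R differential M (f p) x)) c) v"
        using linear_chart_deriv[OF differentiable_in_one_form[OF True \<alpha>]]
        by (simp add: chart_deriv_combination[OF True X f Z] lie_deriv_chart[OF True X]
            lie_deriv_chart[OF True vector_field_combination[OF X f Z]]
            sum_fun_apply scaleR_fun_apply linear_diff linear_sum linear_cmul
            blinfun.diff_left blinfun.sum_left blinfun.scaleR_left blinfun.add_left
            blinfun.diff_right blinfun.sum_right blinfun.scaleR_right blinfun.add_right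
            sum.distrib distrib_left algebra_simps)
    qed
  next
    case False
    then show ?thesis
      by (simp add: lie_deriv_def differential_def sum_fun_apply scaleR_fun_apply)
  qed
qed

text \<open>In coordinates \<alpha>(DX(Y)) occurs with a plus sign in the Lie derivative and with a
  minus sign in the bracket. What remains is the product rule for \<alpha>(Y).\<close>

lemma vf_apply_pairing:
  assumes x: "x \<in> points M" and X: "vector_field M X" and Y: "vector_field M Y" and \<alpha>: "one_form \<alpha>"
  shows "vf_apply M X (\<lambda>y. pairing M y (\<alpha> y) (Y y)) x
    = pairing M x (lie_deriv M X \<alpha> x) (Y x) + pairing M x (\<alpha> x) (lie_bracket M X Y x)"
proof -
  let ?c = "chart_around M x"
  note c = chart_around_in[OF x]
  have "vf_apply M X (\<lambda>y. pairing M y (\<alpha> y) (Y y)) x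
      = chart_deriv ?c (\<lambda>y. blinfun_apply (\<alpha> y ?c) (Y y ?c)) x (X x ?c)"
    unfolding vf_apply_def
  proof (intro fun_cong[OF chart_deriv_cong[OF c]] pairing_chart)
    \<comment> \<open>Differentiation at \<open>x\<close> needs the pairing in the one chart
      \<open>?c\<close> on a whole neighbourhood, so agreement is shown on all of its
      domain.\<close>
    fix y assume "y \<in> fst ?c"
    then show "?c \<in> charts_at M y" "\<alpha> y \<in> cotangent_space M y" "Y y \<in> tangent_space M y"
      using charts_atD[OF c] chart_domain_subset[of ?c] Y \<alpha>
      by (auto simp: charts_at_def one_form_on_def vector_field_on_def)
  qed
  then show ?thesis
    using c chart_deriv_blinfun_apply(2)[OF c differentiable_in_one_form[OF c \<alpha>]
        differentiable_in_vector_field[OF c Y]] lie_deriv_chart[OF c X]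
    by (simp add: pairing_def lie_bracket_def blinfun.diff_right)
qed

lemma pairing_differential:
  assumes "x \<in> points M" "smooth_function f"
  shows "pairing M x (differential M f x) (X x) = vf_apply M X f x"
  using chart_around_in[OF assms(1)] assms(2) by (simp add: pairing_def vf_apply_def differential_chart)

lemma vf_apply_diff:
  assumes "x \<in> points M" "smooth_function f" "smooth_function g"
  shows "vf_apply M X (\<lambda>y. f y - g y) x = vf_apply M X f x - vf_apply M X g x"
  using chart_deriv_diff(2)[OF assms(2,3)[THEN differentiable_in_smooth_fun[OF chart_around_in[OF assms(1)]]]]
  by (simp add: vf_apply_def)

lemma differential_diff:
  assumes "x \<in> points M" "smooth_function f" "smooth_function g"
  shows "differential M (\<lambda>y. f y - g y) x = differential M f x - differential M g x"
proof
  fix c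
  show "differential M (\<lambda>y. f y - g y) x c = (differential M f x - differential M g x) c"
  proof (cases "c \<in> charts_at M x")
    case True
    then show ?thesis
      using chart_deriv_diff(2)[OF assms(2,3)[THEN differentiable_in_smooth_fun[OF True]]]
      by (intro blinfun_eqI) (simp add: blinfun.diff_left differential_chart assms smooth_fun_diff)
  qed (simp add: differential_def)
qed

text \<open>Meant for the sums of w^p \<alpha>(V_p), which the tangent parts X - w.V bring into the
  differential term of the bracket.\<close>

lemma differential_sum_mult:
  assumes x: "x \<in> points M"
    and f: "\<And>p. p < k \<Longrightarrow> smooth_function (f p)" and g: "\<And>p. p < k \<Longrightarrow> smooth_function (g p)"
  shows "differential M (\<lambda>y. \<Sum>p<k. f p y * g p y) x
    = (\<Sum>p<k. f p x *\<^sub>R differential M (g p) x + g p x *\<^sub>R differential M (f p) x)"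
proof
  fix c
  show "differential M (\<lambda>y. \<Sum>p<k. f p y * g p y) x c
    = (\<Sum>p<k. f p x *\<^sub>R differential M (g p) x + g p x *\<^sub>R differential M (f p) x) c"
  proof (cases "c \<in> charts_at M x")
    case True
    have m: "differentiable_in c (\<lambda>y. f p y * g p y) x" "chart_deriv c (\<lambda>y. f p y * g p y) x
        = (\<lambda>v. f p x * chart_deriv c (g p) x v + chart_deriv c (f p) x v * g p x)"
      if "p \<in> {..<k}" for p
      using that chart_deriv_mult[OF True f[THEN differentiable_in_smooth_fun[OF True]]
          g[THEN differentiable_in_smooth_fun[OF True]]] by simp_all
    have "smooth_function (\<lambda>y. \<Sum>p<k. f p y * g p y)"
      using f g by (intro smooth_fun_sum smooth_fun_mult) auto
    then show ?thesis
      using chart_deriv_sum(2)[of "{..<k}" c "\<lambda>p y. f p y * g p y" x, OF m(1)] m(2) f g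
      by (intro blinfun_eqI) (auto simp: differential_chart True sum_fun_apply scaleR_fun_apply
          blinfun.sum_left blinfun.add_left blinfun.scaleR_left mult.commute intro!: sum.cong)
  qed (simp add: differential_def sum_fun_apply scaleR_fun_apply)
qed

end

section \<open>The lift of a stable big tangent vector\<close>

text \<open>The map T at one point. The cut-off at \<open>k\<close> puts the new block into
  \<open>Rvec k\<close>, since nothing is known about \<open>V p\<close> for larger
  \<open>p\<close>.\<close>

definition stable_lift ::
  "('m, 'e::real_normed_vector) manifold \<Rightarrow> nat \<Rightarrow> nat \<Rightarrow> (nat \<Rightarrow> 'm \<Rightarrow> ('m, 'e) tvec) \<Rightarrow> 'm \<Rightarrow>
   ('m, 'e) big \<Rightarrow> (nat \<Rightarrow> real) \<Rightarrow> ('m, 'e) big" where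
  "stable_lift M h k V x a w =
     ((tan_part a - (\<Sum>p<k. w p *\<^sub>R V p x),
       vappend h (u_part a) (\<lambda>p. if p < k then pairing M x (cot_part a) (V p x) else 0)),
      (cot_part a, vappend h (v_part a) w))"

lemma stable_extension_eq:
  "stable_extension M h k V L x = {stable_lift M h k V x a w | a w. a \<in> L x \<and> w \<in> Rvec k}"
  unfolding stable_extension_def stable_lift_def by (simp add: split_paired_Ex cong: if_cong)

lemma sum_lessThan_add: "(\<Sum>i<h + k. f i) = (\<Sum>i<h. f i) + (\<Sum>p<k. f (h + p))"
  for f :: "nat \<Rightarrow> 'a::comm_monoid_add"
  by (induction k) (simp_all add: ac_simps)

definition unit_vec :: "nat \<Rightarrow> nat \<Rightarrow> real" where
  "unit_vec q = (\<lambda>p. if p = q then 1 else 0)"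

lemma unit_vec_Rvec: "q < k \<Longrightarrow> unit_vec q \<in> Rvec k"
  by (auto simp: Rvec_def unit_vec_def)

lemma Rvec_expansion: "w \<in> Rvec k \<Longrightarrow> w = (\<Sum>p<k. w p *\<^sub>R unit_vec p)"
  by (auto simp: Rvec_def unit_vec_def fun_eq_iff sum_fun_apply scaleR_fun_apply if_distrib cong: if_cong)

text \<open>\<open>smooth_subbundle\<close> asks for an injective indexing and an independent image
  set. In coefficient form this passes through linear maps and through a splitting of the index
  range.\<close>

lemma independent_family_iff:
  fixes e :: "'i \<Rightarrow> 'a::real_vector"
  assumes "finite I"
  shows "inj_on e I \<and> independent (e ` I) \<longleftrightarrow>
    (\<forall>c. (\<Sum>i\<in>I. c i *\<^sub>R e i) = 0 \<longrightarrow> (\<forall>i\<in>I. c i = 0))" (is "?L \<longleftrightarrow> ?R")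
proof
  assume L: ?L
  show ?R
  proof (intro allI impI ballI)
    fix c i assume c: "(\<Sum>i\<in>I. c i *\<^sub>R e i) = 0" and i: "i \<in> I"
    let ?u = "\<lambda>v. c (inv_into I e v)"
    have "(\<Sum>v\<in>e ` I. ?u v *\<^sub>R v) = (\<Sum>i\<in>I. c i *\<^sub>R e i)"
      using L by (subst sum.reindex) (auto intro!: sum.cong)
    then have "?u (e i) = 0"
      using L assms c i by (intro independentD[of "e ` I" "e ` I" ?u]) auto
    then show "c i = 0" using L i by simp
  qed
next
  assume R: ?R
  have inj: "inj_on e I"
  proof (rule inj_onI, rule ccontr)
    fix i j assume ij: "i \<in> I" "j \<in> I" "e i = e j" "i \<noteq> j"
    \<comment> \<open>A repeated vector gives the relation e i - e j = 0, whose coefficient at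
      \<open>i\<close> is 1.\<close>
    let ?c = "\<lambda>l. (if l = i then 1 else 0) - (if l = j then 1 else (0::real))"
    have "(\<Sum>l\<in>I. ?c l *\<^sub>R e l) = (\<Sum>l\<in>I. if l = i then e l else 0) - (\<Sum>l\<in>I. if l = j then e l else 0)"
      unfolding sum_subtractf[symmetric] by (intro sum.cong) auto
    also have "\<dots> = 0"
      using ij assms by simp
    finally show False
      using R[rule_format, of ?c i] ij by simp
  qed
  have "independent (e ` I)"
  proof (rule independent_if_scalars_zero)
    fix f x assume f: "(\<Sum>v\<in>e ` I. f v *\<^sub>R v) = 0" and x: "x \<in> e ` I"
    then show "f x = 0"
      using R[rule_format, of "\<lambda>i. f (e i)"] by (auto simp: sum.reindex[OF inj])
  qed (use assms in simp)
  with inj show ?L ..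
qed

context smooth_mfd
begin

section \<open>Linearity, injectivity and isometry of T\<close>

abbreviation "lift \<equiv> stable_lift M"

text \<open>T is linear in the pair (a,w) jointly, not bilinear.\<close>

lemma lift_add: "lift h k V x (a + b) (w + w') = lift h k V x a w + lift h k V x b w'"
  by (auto simp: stable_lift_def vappend_def fun_eq_iff pairing_linear sum.distrib scaleR_add_left)

lemma lift_scaleR: "lift h k V x (r *\<^sub>R a) (r *\<^sub>R w) = r *\<^sub>R lift h k V x a w"
  by (auto simp: stable_lift_def vappend_def fun_eq_iff pairing_linear scaleR_fun_apply sum_fun_apply
      scaleR_diff_right scaleR_sum_right)

lemma lift_zero: "lift h k V x 0 0 = 0"
  using lift_scaleR[of h k V x 0 0 0] by simp

text \<open>T is injective: w is the tail of the v part, and knowing it one can undo the shift of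
  the tangent part. \<open>vappend\<close> drops the entries of \<open>a\<close> from index
  \<open>h\<close> on; these are 0 because \<open>a\<close> lies in the fibre.\<close>

lemma lift_eq_zero:
  assumes "lift h k V x a w = 0" "a \<in> big_fibre M h x"
  shows "a = 0" "w = 0"
proof -
  have a: "cot_part a = 0" "vappend h (v_part a) w = 0"
    "tan_part a = (\<Sum>p<k. w p *\<^sub>R V p x)"
    "vappend h (u_part a) (\<lambda>p. if p < k then pairing M x (cot_part a) (V p x) else 0) = 0"
    using assms(1) by (auto simp: stable_lift_def prod_eq_iff)
  show w: "w = 0"
  proof
    fix p show "w p = 0 p"
      using fun_cong[OF a(2), of "h + p"] by (simp add: vappend_def)
  qed
  have "u_part a i = 0 \<and> v_part a i = 0" for i
    using assms(2) fun_cong[OF a(2), of i] fun_cong[OF a(4), of i]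
    by (cases "i < h") (auto simp: vappend_def big_fibre_def Rvec_def)
  then have "u_part a = 0" "v_part a = 0" by (auto simp: fun_eq_iff)
  then show "a = 0"
    using a(1,3) w by (simp add: prod_eq_iff)
qed

lemma lift_big_fibre:
  assumes "a \<in> big_fibre M h x" "w \<in> Rvec k" "\<And>p. p < k \<Longrightarrow> V p x \<in> tangent_space M x"
  shows "lift h k V x a w \<in> big_fibre M (h + k) x"
proof -
  have "tan_part a - (\<Sum>p<k. w p *\<^sub>R V p x) \<in> tangent_space M x"
    using assms by (intro subspace_diff[OF subspace_tangent_space] subspace_sum[OF subspace_tangent_space]
        subspace_scale[OF subspace_tangent_space]) (auto simp: big_fibre_def)
  then show ?thesis
    using assms(1,2) by (auto simp: stable_lift_def big_fibre_def Rvec_def vappend_def)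
qed

text \<open>With \<beta> the form of \<open>b\<close>, the term -\<beta>(w.V) from the pairing meets
  \<beta>(V).w from the scalar product of the new blocks; the same happens with \<open>a\<close> and
  \<open>b\<close> exchanged.\<close>

lemma G_lift: "G_metric M (h + k) x (lift h k V x a w) (lift h k V x b w') = G_metric M h x a b"
  by (simp add: G_metric_def stable_lift_def pairing_linear sum_lessThan_add vappend_def algebra_simps)

lemma subspace_lift:
  assumes "subspace S"
  shows "subspace {lift h k V x a w | a w. a \<in> S \<and> w \<in> Rvec k}"
  unfolding subspace_def
proof (intro conjI ballI allI)
  show "0 \<in> {lift h k V x a w | a w. a \<in> S \<and> w \<in> Rvec k}"
    using lift_zero[symmetric] subspace_0[OF assms] subspace_0[OF subspace_Rvec] by blast
next
  fix a b assume "a \<in> {lift h k V x a w | a w. a \<in> S \<and> w \<in> Rvec k}"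
    "b \<in> {lift h k V x a w | a w. a \<in> S \<and> w \<in> Rvec k}"
  then show "a + b \<in> {lift h k V x a w | a w. a \<in> S \<and> w \<in> Rvec k}"
    using lift_add[symmetric] subspace_add[OF assms] subspace_add[OF subspace_Rvec]
    by (smt (verit) mem_Collect_eq)
next
  fix r a assume "a \<in> {lift h k V x a w | a w. a \<in> S \<and> w \<in> Rvec k}"
  then show "r *\<^sub>R a \<in> {lift h k V x a w | a w. a \<in> S \<and> w \<in> Rvec k}"
    using lift_scaleR[symmetric] subspace_scale[OF assms] subspace_scale[OF subspace_Rvec]
    by (smt (verit) mem_Collect_eq)
qed

section \<open>Isotropy and maximality of the fibres\<close>

lemma G_metric_linear:
  "G_metric M h x (a + b) d = G_metric M h x a d + G_metric M h x b d"
  "G_metric M h x (r *\<^sub>R a) d = r * G_metric M h x a d"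
  "G_metric M h x d (a + b) = G_metric M h x d a + G_metric M h x d b"
  "G_metric M h x d (r *\<^sub>R a) = r * G_metric M h x d a"
  by (simp_all add: G_metric_def pairing_linear scaleR_fun_apply sum.distrib sum_distrib_left algebra_simps)

lemma G_metric_commute: "G_metric M h x a b = G_metric M h x b a"
  by (simp add: G_metric_def)

text \<open>Otherwise the span of \<open>S\<close> and \<open>a\<close> would be a larger isotropic
  subspace. Membership in L_x is thus reduced to orthogonality relations, and these transfer through
  T.\<close>

lemma maximal_isotropic_contains:
  assumes S: "maximal_isotropic M h x S" and a: "a \<in> big_fibre M h x" "G_metric M h x a a = 0"
    and aS: "\<And>l. l \<in> S \<Longrightarrow> G_metric M h x a l = 0"
  shows "a \<in> S"
proof -
  have sub: "subspace S" "S \<subseteq> big_fibre M h x" and iso: "\<And>l l'. l \<in> S \<Longrightarrow> l' \<in> S \<Longrightarrow> G_metric M h x l l' = 0"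
    using S by (auto simp: maximal_isotropic_def isotropic_def)
  let ?S = "span (insert a S)"
  have decomp: "\<exists>r l. l \<in> S \<and> b = r *\<^sub>R a + l" if b: "b \<in> ?S" for b
  proof -
    obtain r where "b - r *\<^sub>R a \<in> span S"
      using b span_breakdown_eq[of b a S] by blast
    then have "b - r *\<^sub>R a \<in> S"
      using sub(1) span_eq_iff by blast
    then show ?thesis by (intro exI[of _ r] exI[of _ "b - r *\<^sub>R a"]) simp
  qed
  have "isotropic M h x ?S"
    unfolding isotropic_def
  proof (intro ballI)
    fix b b' assume "b \<in> ?S" "b' \<in> ?S"
    then obtain r l r' l' where l: "l \<in> S" "l' \<in> S" "b = r *\<^sub>R a + l" "b' = r' *\<^sub>R a + l'"
      using decomp by meson
    then show "G_metric M h x b b' = 0"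
      using a(2) aS[OF l(2)] aS[OF l(1)] iso[OF l(1,2)] G_metric_commute[of h x l a]
      by (simp add: G_metric_linear)
  qed
  moreover have "?S \<subseteq> big_fibre M h x"
    using a(1) sub(2) by (intro span_minimal subspace_big_fibre) auto
  moreover have "S \<subseteq> ?S"
    using span_superset by blast
  moreover have "S' = S" if "subspace S'" "S' \<subseteq> big_fibre M h x" "isotropic M h x S'" "S \<subseteq> S'" for S'
    using S that unfolding maximal_isotropic_def by simp
  ultimately have "?S = S"
    using subspace_span by simp
  then show ?thesis
    using span_base[of a "insert a S"] by simp
qed

lemma maximal_isotropic_lift:
  assumes S: "maximal_isotropic M h x S" and V: "\<And>p. p < k \<Longrightarrow> V p x \<in> tangent_space M x"
  shows "maximal_isotropic M (h + k) x {lift h k V x a w | a w. a \<in> S \<and> w \<in> Rvec k}" (is "maximal_isotropic _ _ _ ?T")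
  unfolding maximal_isotropic_def
proof (intro conjI allI impI)
  have sub: "subspace S" "S \<subseteq> big_fibre M h x" and iso: "\<And>l l'. l \<in> S \<Longrightarrow> l' \<in> S \<Longrightarrow> G_metric M h x l l' = 0"
    using S by (auto simp: maximal_isotropic_def isotropic_def)
  show "subspace ?T"
    using sub(1) by (rule subspace_lift)
  show "?T \<subseteq> big_fibre M (h + k) x"
    using sub(2) V by (auto intro!: lift_big_fibre)
  show "isotropic M (h + k) x ?T"
    unfolding isotropic_def using iso by (auto simp: G_lift)
  fix S' assume S': "subspace S' \<and> S' \<subseteq> big_fibre M (h + k) x \<and> isotropic M (h + k) x S' \<and> ?T \<subseteq> S'"
  then have iso': "\<And>l l'. l \<in> S' \<Longrightarrow> l' \<in> S' \<Longrightarrow> G_metric M (h + k) x l l' = 0" and T: "?T \<subseteq> S'"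
    by (simp_all add: isotropic_def)
  have "b \<in> ?T" if b: "b \<in> S'" for b
  proof -
    have bf: "tan_part b \<in> tangent_space M x" "cot_part b \<in> cotangent_space M x"
      "u_part b \<in> Rvec (h + k)" "v_part b \<in> Rvec (h + k)"
      using S' b by (auto simp: big_fibre_def)
    \<comment> \<open>The only candidates for a preimage of \<open>b\<close> under T: w is the tail
      of its v part, and \<open>a\<close> undoes the shift by w.V and keeps the first
      \<open>h\<close> entries. The discarded tail of the u part must then turn out to be
      \<alpha>(V).\<close>
    define w where "w = (\<lambda>p. v_part b (h + p))"
    define a where "a = ((tan_part b + (\<Sum>p<k. w p *\<^sub>R V p x), (\<lambda>i. if i < h then u_part b i else 0)),
      (cot_part b, (\<lambda>i. if i < h then v_part b i else 0)))"
    have w: "w \<in> Rvec k"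
      using bf(4) by (auto simp: Rvec_def w_def)
    have af: "a \<in> big_fibre M h x"
      using bf V by (auto simp: a_def big_fibre_def Rvec_def intro!: subspace_add[OF subspace_tangent_space]
        subspace_sum[OF subspace_tangent_space] subspace_scale[OF subspace_tangent_space])
    have ub: "u_part b (h + q) = pairing M x (cot_part b) (V q x)" if q: "q < k" for q
    proof -
      \<comment> \<open>With \<alpha> the form of \<open>b\<close>, the product of \<open>b\<close>
        and T(0,e_q) is half of u_{h+q} - \<alpha>(V_q), which isotropy of \<open>S'\<close> makes
        0.\<close>
      have "lift h k V x 0 (unit_vec q) \<in> ?T"
        using subspace_0[OF sub(1)] unit_vec_Rvec[OF q] by blast
      then have "G_metric M (h + k) x b (lift h k V x 0 (unit_vec q)) = 0"
        using iso'[OF b] subsetD[OF T] by simp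
      then show ?thesis
        using q by (simp add: G_metric_def stable_lift_def sum_lessThan_add vappend_def pairing_linear
            unit_vec_def if_distrib[of "\<lambda>t. _ * t"] if_distrib[of "\<lambda>t. t *\<^sub>R _"] cong: if_cong)
    qed
    have ba: "b = lift h k V x a w"
    proof -
      have u: "vappend h (\<lambda>i. if i < h then u_part b i else 0)
          (\<lambda>p. if p < k then pairing M x (cot_part b) (V p x) else 0) = u_part b" (is "?u = _")
      proof
        fix i show "?u i = u_part b i"
          using ub[of "i - h"] bf(3) by (auto simp: vappend_def Rvec_def)
      qed
      have v: "vappend h (\<lambda>i. if i < h then v_part b i else 0) w = v_part b"
        by (auto simp: vappend_def w_def)
      show ?thesis
        unfolding stable_lift_def a_def fst_conv snd_conv u v by simp
    qed
    have "a \<in> S"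
    proof (rule maximal_isotropic_contains[OF S af])
      show "G_metric M h x a a = 0"
        using iso'[OF b b] by (simp add: ba G_lift)
      fix l assume "l \<in> S"
      \<comment> \<open>\<open>l\<close> is lifted with w = 0. As T preserves G, orthogonality of
        \<open>b\<close> to this lift is orthogonality of \<open>a\<close> to
        \<open>l\<close>.\<close>
      then have "lift h k V x l 0 \<in> ?T"
        using subspace_0[OF subspace_Rvec] by blast
      then have "G_metric M (h + k) x b (lift h k V x l 0) = 0"
        using iso'[OF b] subsetD[OF T] by simp
      then show "G_metric M h x a l = 0"
        by (simp add: ba G_lift)
    qed
    with w ba show ?thesis by blast
  qed
  then show "S' = ?T" using S' by blast
qed


section \<open>The lift of a bracket\<close>

abbreviation twist :: "nat \<Rightarrow> (nat \<Rightarrow> 'm \<Rightarrow> ('m, 'e) tvec) \<Rightarrow> ('m \<Rightarrow> ('m, 'e) tvec) \<Rightarrow> (nat \<Rightarrow> 'm \<Rightarrow> real) \<Rightarrow>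
    'm \<Rightarrow> ('m, 'e) tvec" where
  "twist k V X w \<equiv> (\<lambda>y. X y - (\<Sum>p<k. w p y *\<^sub>R V p y))"

text \<open>Commutativity discards the double sum of w1^p w2^q [V_p,V_q]. The other double sum, in
  which V_q differentiates w1^p, survives as part of the coefficients of V_p.\<close>

lemma lie_bracket_twist:
  assumes x: "x \<in> points M"
    and X: "vector_field M X1" "vector_field M X2"
    and w: "\<And>p. p < k \<Longrightarrow> smooth_function (w1 p)" "\<And>p. p < k \<Longrightarrow> smooth_function (w2 p)"
    and V: "\<And>p. p < k \<Longrightarrow> vector_field M (V p)"
    and comm: "\<And>p q. p < k \<Longrightarrow> q < k \<Longrightarrow> lie_bracket M (V p) (V q) x = 0"
  shows "lie_bracket M (twist k V X1 w1) (twist k V X2 w2) x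
    = lie_bracket M X1 X2 x
      + (\<Sum>p<k. w2 p x *\<^sub>R lie_bracket M (V p) X1 x - w1 p x *\<^sub>R lie_bracket M (V p) X2 x)
      - (\<Sum>p<k. (vf_apply M (twist k V X1 w1) (w2 p) x - vf_apply M (twist k V X2 w2) (w1 p) x) *\<^sub>R V p x)"
proof -
  let ?T1 = "twist k V X1 w1" and ?T2 = "twist k V X2 w2"
  have T1: "vector_field M ?T1"
    using X(1) w(1) V by (rule vector_field_combination)
  \<comment> \<open>\<open>?T1\<close> is left whole at this stage, so that its action on
    \<open>w2\<close> appears in final form.\<close>
  have "lie_bracket M ?T1 ?T2 x = lie_bracket M ?T1 X2 x
      - (\<Sum>q<k. w2 q x *\<^sub>R lie_bracket M ?T1 (V q) x + vf_apply M ?T1 (w2 q) x *\<^sub>R V q x)"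
    by (rule lie_bracket_combination_right[OF x T1 X(2) w(2) V])
  moreover have "lie_bracket M ?T1 X2 x = lie_bracket M X1 X2 x
      - (\<Sum>p<k. w1 p x *\<^sub>R lie_bracket M (V p) X2 x) + (\<Sum>p<k. vf_apply M X2 (w1 p) x *\<^sub>R V p x)"
  proof -
    have "lie_bracket M X2 ?T1 x = lie_bracket M X2 X1 x
        - (\<Sum>p<k. w1 p x *\<^sub>R lie_bracket M X2 (V p) x + vf_apply M X2 (w1 p) x *\<^sub>R V p x)"
      by (rule lie_bracket_combination_right[OF x X(2,1) w(1) V])
    then show ?thesis
      by (simp add: lie_bracket_skew[of ?T1 X2] lie_bracket_skew[of X2 X1] lie_bracket_skew[of X2 "V _"]
          sum.distrib sum_negf sum_subtractf)
  qed
  moreover have "lie_bracket M ?T1 (V q) x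
      = - lie_bracket M (V q) X1 x + (\<Sum>p<k. vf_apply M (V q) (w1 p) x *\<^sub>R V p x)" if "q < k" for q
  proof -
    have "lie_bracket M (V q) ?T1 x = lie_bracket M (V q) X1 x
        - (\<Sum>p<k. w1 p x *\<^sub>R lie_bracket M (V q) (V p) x + vf_apply M (V q) (w1 p) x *\<^sub>R V p x)"
      by (rule lie_bracket_combination_right[OF x V[OF that] X(1) w(1) V])
    then show ?thesis
      using comm[OF that] by (simp add: lie_bracket_skew[of ?T1 "V q"])
  qed
  \<comment> \<open>This double sum corrects X2(w1^p), left over from [?T1, X2], to (X2 -
    w2.V)(w1^p).\<close>
  moreover have "(\<Sum>q<k. w2 q x *\<^sub>R (\<Sum>p<k. vf_apply M (V q) (w1 p) x *\<^sub>R V p x))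
      = (\<Sum>p<k. (vf_apply M X2 (w1 p) x - vf_apply M ?T2 (w1 p) x) *\<^sub>R V p x)"
  proof -
    have "(\<Sum>q<k. w2 q x *\<^sub>R (\<Sum>p<k. vf_apply M (V q) (w1 p) x *\<^sub>R V p x))
        = (\<Sum>p<k. (\<Sum>q<k. w2 q x * vf_apply M (V q) (w1 p) x) *\<^sub>R V p x)"
      unfolding scaleR_sum_right scaleR_sum_left scaleR_scaleR by (rule sum.swap)
    then show ?thesis
      using w(1) by (simp add: vf_apply_combination[OF x])
  qed
  ultimately show ?thesis
    by (simp add: sum.distrib sum_subtractf sum_negf scaleR_diff_left scaleR_diff_right scaleR_add_right
        algebra_simps)
qed

lemma smooth_pairing: "one_form \<alpha> \<Longrightarrow> vector_field M X \<Longrightarrow> smooth_function (\<lambda>y. pairing M y (\<alpha> y) (X y))"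
  by (intro smooth_fun_pairing) auto

text \<open>Beyond the right-hand side, the Lie derivatives leave a1 dw2 - a2 dw1. The differential
  of the pairings and the sum over the new block each give half of a2 dw1 - a1 dw2, while their
  terms in da1 and da2 have opposite signs, so everything cancels.\<close>

lemma lie_deriv_twist:
  assumes x: "x \<in> points M"
    and X: "vector_field M X1" "vector_field M X2"
    and \<alpha>: "one_form \<alpha>1" "one_form \<alpha>2"
    and w: "\<And>p. p < k \<Longrightarrow> smooth_function (w1 p)" "\<And>p. p < k \<Longrightarrow> smooth_function (w2 p)"
    and V: "\<And>p. p < k \<Longrightarrow> vector_field M (V p)"
  defines "a1 \<equiv> \<lambda>p y. pairing M y (\<alpha>1 y) (V p y)" and "a2 \<equiv> \<lambda>p y. pairing M y (\<alpha>2 y) (V p y)"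
  shows "lie_deriv M (twist k V X1 w1) \<alpha>2 x - lie_deriv M (twist k V X2 w2) \<alpha>1 x
      + (1/2) *\<^sub>R differential M (\<lambda>y. pairing M y (\<alpha>1 y) (twist k V X2 w2 y)
          - pairing M y (\<alpha>2 y) (twist k V X1 w1 y)) x
      + (1/2) *\<^sub>R (\<Sum>p<k. a2 p x *\<^sub>R differential M (w1 p) x + w2 p x *\<^sub>R differential M (a1 p) x
          - a1 p x *\<^sub>R differential M (w2 p) x - w1 p x *\<^sub>R differential M (a2 p) x)
    = lie_deriv M X1 \<alpha>2 x - lie_deriv M X2 \<alpha>1 x
      + (1/2) *\<^sub>R differential M (\<lambda>y. pairing M y (\<alpha>1 y) (X2 y) - pairing M y (\<alpha>2 y) (X1 y)) x
      + (\<Sum>p<k. w2 p x *\<^sub>R lie_deriv M (V p) \<alpha>1 x - w1 p x *\<^sub>R lie_deriv M (V p) \<alpha>2 x)"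
proof -
  have a: "smooth_function (a1 p)" "smooth_function (a2 p)" if "p < k" for p
    unfolding a1_def a2_def using \<alpha> V[OF that] by (auto intro: smooth_pairing)
  let ?g = "\<lambda>y. pairing M y (\<alpha>1 y) (X2 y) - pairing M y (\<alpha>2 y) (X1 y)"
  let ?s1 = "\<lambda>y. \<Sum>p<k. w1 p y * a2 p y" and ?s2 = "\<lambda>y. \<Sum>p<k. w2 p y * a1 p y"
  have s: "smooth_function ?g" "smooth_function ?s1" "smooth_function ?s2"
    using X \<alpha> w a by (auto intro!: smooth_fun_diff smooth_pairing smooth_fun_sum smooth_fun_mult)
  have "(\<lambda>y. pairing M y (\<alpha>1 y) (twist k V X2 w2 y) - pairing M y (\<alpha>2 y) (twist k V X1 w1 y))
      = (\<lambda>y. ?g y - (?s2 y - ?s1 y))"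
    by (auto simp: a1_def a2_def pairing_linear)
  then have "differential M (\<lambda>y. pairing M y (\<alpha>1 y) (twist k V X2 w2 y)
        - pairing M y (\<alpha>2 y) (twist k V X1 w1 y)) x
      = differential M ?g x - (differential M ?s2 x - differential M ?s1 x)"
    using s x by (simp only: differential_diff smooth_fun_diff openin_topspace)
  also have "differential M ?s2 x
      = (\<Sum>p<k. w2 p x *\<^sub>R differential M (a1 p) x) + (\<Sum>p<k. a1 p x *\<^sub>R differential M (w2 p) x)"
    using differential_sum_mult[OF x w(2) a(1)] by (simp add: sum.distrib)
  also have "differential M ?s1 x
      = (\<Sum>p<k. w1 p x *\<^sub>R differential M (a2 p) x) + (\<Sum>p<k. a2 p x *\<^sub>R differential M (w1 p) x)"
    using differential_sum_mult[OF x w(1) a(2)] by (simp add: sum.distrib)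
  finally have d: "differential M (\<lambda>y. pairing M y (\<alpha>1 y) (twist k V X2 w2 y)
        - pairing M y (\<alpha>2 y) (twist k V X1 w1 y)) x = differential M ?g x
      - ((\<Sum>p<k. w2 p x *\<^sub>R differential M (a1 p) x) + (\<Sum>p<k. a1 p x *\<^sub>R differential M (w2 p) x)
        - ((\<Sum>p<k. w1 p x *\<^sub>R differential M (a2 p) x) + (\<Sum>p<k. a2 p x *\<^sub>R differential M (w1 p) x)))" .
  have l: "lie_deriv M (twist k V X1 w1) \<alpha>2 x = lie_deriv M X1 \<alpha>2 x
      - ((\<Sum>p<k. w1 p x *\<^sub>R lie_deriv M (V p) \<alpha>2 x) + (\<Sum>p<k. a2 p x *\<^sub>R differential M (w1 p) x))"
    "lie_deriv M (twist k V X2 w2) \<alpha>1 x = lie_deriv M X2 \<alpha>1 x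
      - ((\<Sum>p<k. w2 p x *\<^sub>R lie_deriv M (V p) \<alpha>1 x) + (\<Sum>p<k. a1 p x *\<^sub>R differential M (w2 p) x))"
    using lie_deriv_combination[OF x X(1) \<alpha>(2) w(1) V] lie_deriv_combination[OF x X(2) \<alpha>(1) w(2) V]
    by (simp_all add: a1_def a2_def sum.distrib)
  \<comment> \<open>Serves to match the two halves of each dw term with the whole one from the Lie
    derivatives.\<close>
  have half: "t = (1/2) *\<^sub>R t + (1/2) *\<^sub>R t" for t :: "('m, 'e) cotvec"
    by (simp flip: scaleR_add_left)
  show ?thesis
    unfolding d l sum.distrib sum_subtractf scaleR_add_right scaleR_diff_right
    using half[of "\<Sum>p<k. a2 p x *\<^sub>R differential M (w1 p) x"]
      half[of "\<Sum>p<k. a1 p x *\<^sub>R differential M (w2 p) x"]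
    by (simp add: algebra_simps)
qed


text \<open>The expression that \<open>infinitesimal_automorphism\<close> requires to be a section
  of L again: the Lie derivative taken componentwise, with u and v treated as functions.\<close>

definition section_lie_deriv :: "('m \<Rightarrow> ('m, 'e) tvec) \<Rightarrow> ('m \<Rightarrow> ('m, 'e) big) \<Rightarrow> 'm \<Rightarrow> ('m, 'e) big" where
  "section_lie_deriv V s x =
    ((lie_bracket M V (\<lambda>y. tan_part (s y)) x, \<lambda>i. vf_apply M V (\<lambda>y. u_part (s y) i) x),
     (lie_deriv M V (\<lambda>y. cot_part (s y)) x, \<lambda>i. vf_apply M V (\<lambda>y. v_part (s y) i) x))"

lemma big_section_onD:
  assumes "big_section_on M h W s"
  shows "vector_field_on M W (\<lambda>x. tan_part (s x))" "one_form_on M W (\<lambda>x. cot_part (s x))"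
    and "i < h \<Longrightarrow> smooth_fun M W (\<lambda>x. u_part (s x) i)" "i < h \<Longrightarrow> smooth_fun M W (\<lambda>x. v_part (s x) i)"
    and "x \<in> W \<Longrightarrow> s x \<in> big_fibre M h x"
  using assms by (simp_all add: big_section_on_def)

text \<open>The terms beyond the right-hand side add up to \<open>G(L_V s1, s2) - G(s1, L_V s2)\<close>, which isotropy kills.\<close>

lemma pairing_bracket:
  assumes x: "x \<in> points M" and s: "big_section_on M h (points M) s1" "big_section_on M h (points M) s2"
    and V: "vector_field M V"
    and G: "G_metric M h x (section_lie_deriv V s1 x) (s2 x) = 0"
      "G_metric M h x (section_lie_deriv V s2 x) (s1 x) = 0"
  shows "pairing M x (cot_part (stable_courant_bracket M h s1 s2 x)) (V x)
    = vf_apply M (\<lambda>y. tan_part (s1 y)) (\<lambda>y. pairing M y (cot_part (s2 y)) (V y)) x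
      - vf_apply M (\<lambda>y. tan_part (s2 y)) (\<lambda>y. pairing M y (cot_part (s1 y)) (V y)) x"
proof -
  let ?X1 = "\<lambda>y. tan_part (s1 y)" and ?X2 = "\<lambda>y. tan_part (s2 y)"
  let ?a1 = "\<lambda>y. cot_part (s1 y)" and ?a2 = "\<lambda>y. cot_part (s2 y)"
  note X = s[THEN big_section_onD(1)] and a = s[THEN big_section_onD(2)]
  note u = s[THEN big_section_onD(3)] and v = s[THEN big_section_onD(4)]
  have d: "pairing M x (differential M f x) (V x) = vf_apply M V f x" if "smooth_function f" for f
    by (rule pairing_differential[OF x that])
  have "pairing M x (differential M (\<lambda>y. pairing M y (?a1 y) (?X2 y) - pairing M y (?a2 y) (?X1 y)) x) (V x)
      = vf_apply M V (\<lambda>y. pairing M y (?a1 y) (?X2 y)) x - vf_apply M V (\<lambda>y. pairing M y (?a2 y) (?X1 y)) x"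
    using smooth_pairing[OF a(1) X(2)] smooth_pairing[OF a(2) X(1)]
    by (simp add: d smooth_fun_diff vf_apply_diff[OF x])
  moreover have "(\<Sum>i<h. u_part (s2 x) i * pairing M x (differential M (\<lambda>y. v_part (s1 y) i) x) (V x)
        + v_part (s2 x) i * pairing M x (differential M (\<lambda>y. u_part (s1 y) i) x) (V x)
        - u_part (s1 x) i * pairing M x (differential M (\<lambda>y. v_part (s2 y) i) x) (V x)
        - v_part (s1 x) i * pairing M x (differential M (\<lambda>y. u_part (s2 y) i) x) (V x))
      = (\<Sum>i<h. u_part (s2 x) i * vf_apply M V (\<lambda>y. v_part (s1 y) i) x
        + v_part (s2 x) i * vf_apply M V (\<lambda>y. u_part (s1 y) i) x
        - u_part (s1 x) i * vf_apply M V (\<lambda>y. v_part (s2 y) i) x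
        - v_part (s1 x) i * vf_apply M V (\<lambda>y. u_part (s2 y) i) x)"
    using u v by (intro sum.cong) (simp_all add: d)
  \<comment> \<open>Two instances turn (L_X \<alpha>)(V) into X(\<alpha>(V)) and a term in [V,X];
    the other two expand V(\<alpha>(X)), which enters with factor 1/2. Together they leave each term
    in [V,X] with half its weight, as in G.\<close>
  ultimately show ?thesis
    using G vf_apply_pairing[OF x X(1) V a(2)] vf_apply_pairing[OF x X(2) V a(1)]
      vf_apply_pairing[OF x V X(2) a(1)] vf_apply_pairing[OF x V X(1) a(2)]
    by (simp add: stable_courant_bracket_def Let_def G_metric_def section_lie_deriv_def pairing_linear
        lie_bracket_skew[of ?X1 V] lie_bracket_skew[of ?X2 V] sum.distrib sum_subtractf algebra_simps)
qed

section \<open>Dependence on the values at points of the manifold only\<close>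

lemma chart_deriv_cong_points:
  assumes "c \<in> charts_at M x" "\<And>y. y \<in> points M \<Longrightarrow> f y = g y"
  shows "chart_deriv c f x = chart_deriv c g x"
  using chart_domain_subset charts_atD[OF assms(1)] by (intro chart_deriv_cong assms) blast

lemma vf_apply_cong:
  assumes "x \<in> points M" "\<And>y. y \<in> points M \<Longrightarrow> X y = Y y" "\<And>y. y \<in> points M \<Longrightarrow> f y = g y"
  shows "vf_apply M X f x = vf_apply M Y g x"
  using chart_deriv_cong_points[OF chart_around_in[OF assms(1)] assms(3)] assms(1,2)
  by (simp add: vf_apply_def)

lemma differential_cong:
  assumes "\<And>y. y \<in> points M \<Longrightarrow> f y = g y"
  shows "differential M f x = differential M g x"
proof -
  have "chart_deriv c f x = chart_deriv c g x" if "c \<in> charts_at M x" for c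
    using that assms by (rule chart_deriv_cong_points)
  then show ?thesis
    by (intro ext) (simp add: differential_def)
qed

text \<open>Sections are total functions, but a section of the extension is known as a lift only on
  \<open>points M\<close>. At \<open>x\<close> the bracket sees no more than chart domains, which
  lie inside \<open>points M\<close>.\<close>

lemma stable_courant_bracket_cong:
  assumes x: "x \<in> points M"
    and s: "\<And>y. y \<in> points M \<Longrightarrow> s1 y = t1 y" "\<And>y. y \<in> points M \<Longrightarrow> s2 y = t2 y"
  shows "stable_courant_bracket M h s1 s2 x = stable_courant_bracket M h t1 t2 x"
proof -
  \<comment> \<open>An arbitrary component map \<open>F\<close> covers the coordinates in every
    chart; the value type is the model space here and its dual in \<open>c'\<close>.\<close>
  have c: "chart_deriv c (\<lambda>y. F (r y)) x = chart_deriv c (\<lambda>y. F (t y)) x"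
    if "c \<in> charts_at M x" "\<And>y. y \<in> points M \<Longrightarrow> r y = t y"
    for c and F :: "('m, 'e) big \<Rightarrow> 'e" and r t
    using that(2) by (intro chart_deriv_cong_points[OF that(1)]) simp
  have c': "chart_deriv c (\<lambda>y. F (r y)) x = chart_deriv c (\<lambda>y. F (t y)) x"
    if "c \<in> charts_at M x" "\<And>y. y \<in> points M \<Longrightarrow> r y = t y"
    for c and F :: "('m, 'e) big \<Rightarrow> 'e \<Rightarrow>\<^sub>L real" and r t
    using that(2) by (intro chart_deriv_cong_points[OF that(1)]) simp
  have b: "lie_bracket M (\<lambda>y. tan_part (s1 y)) (\<lambda>y. tan_part (s2 y)) x
      = lie_bracket M (\<lambda>y. tan_part (t1 y)) (\<lambda>y. tan_part (t2 y)) x"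
  proof
    fix i
    show "lie_bracket M (\<lambda>y. tan_part (s1 y)) (\<lambda>y. tan_part (s2 y)) x i
      = lie_bracket M (\<lambda>y. tan_part (t1 y)) (\<lambda>y. tan_part (t2 y)) x i"
      using c[of i s1 t1 "\<lambda>a. tan_part a i"] c[of i s2 t2 "\<lambda>a. tan_part a i"] s x
      by (simp add: lie_bracket_def)
  qed
  have l: "lie_deriv M (\<lambda>y. tan_part (r y)) (\<lambda>y. cot_part (r' y)) x
      = lie_deriv M (\<lambda>y. tan_part (t y)) (\<lambda>y. cot_part (t' y)) x"
    if *: "\<And>y. y \<in> points M \<Longrightarrow> r y = t y" "\<And>y. y \<in> points M \<Longrightarrow> r' y = t' y"
    for r t r' t' :: "'m \<Rightarrow> ('m, 'e) big"
  proof
    fix i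
    show "lie_deriv M (\<lambda>y. tan_part (r y)) (\<lambda>y. cot_part (r' y)) x i
      = lie_deriv M (\<lambda>y. tan_part (t y)) (\<lambda>y. cot_part (t' y)) x i"
      using c[of i r t "\<lambda>a. tan_part a i"] c'[of i r' t' "\<lambda>a. cot_part a i"] * x
      by (simp add: lie_deriv_def)
  qed
  have d: "differential M (\<lambda>y. F (s1 y) i) x = differential M (\<lambda>y. F (t1 y) i) x"
    "differential M (\<lambda>y. F (s2 y) i) x = differential M (\<lambda>y. F (t2 y) i) x"
    for F :: "('m, 'e) big \<Rightarrow> nat \<Rightarrow> real" and i
    using s by (auto intro!: differential_cong)
  have p: "differential M (\<lambda>y. pairing M y (cot_part (s1 y)) (tan_part (s2 y)) - pairing M y (cot_part (s2 y)) (tan_part (s1 y))) x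
      = differential M (\<lambda>y. pairing M y (cot_part (t1 y)) (tan_part (t2 y)) - pairing M y (cot_part (t2 y)) (tan_part (t1 y))) x"
    using s by (intro differential_cong) simp
  have f: "vf_apply M (\<lambda>y. tan_part (s1 y)) (\<lambda>y. F (s2 y) i) x = vf_apply M (\<lambda>y. tan_part (t1 y)) (\<lambda>y. F (t2 y) i) x"
    "vf_apply M (\<lambda>y. tan_part (s2 y)) (\<lambda>y. F (s1 y) i) x = vf_apply M (\<lambda>y. tan_part (t2 y)) (\<lambda>y. F (t1 y) i) x"
    for F :: "('m, 'e) big \<Rightarrow> nat \<Rightarrow> real" and i
    using s by (auto intro!: vf_apply_cong[OF x])
  have l12: "lie_deriv M (\<lambda>y. tan_part (s1 y)) (\<lambda>y. cot_part (s2 y)) x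
      = lie_deriv M (\<lambda>y. tan_part (t1 y)) (\<lambda>y. cot_part (t2 y)) x"
    using s by (rule l)
  have l21: "lie_deriv M (\<lambda>y. tan_part (s2 y)) (\<lambda>y. cot_part (s1 y)) x
      = lie_deriv M (\<lambda>y. tan_part (t2 y)) (\<lambda>y. cot_part (t1 y)) x"
    using s(2,1) by (rule l)
  show ?thesis
    unfolding stable_courant_bracket_def Let_def b l12 l21 p
      d[of u_part] d[of v_part] f[of u_part] f[of v_part] s(1)[OF x] s(2)[OF x] ..
qed


section \<open>The bracket of two lifts\<close>

lemma vf_apply_zero:
  assumes "x \<in> points M"
  shows "vf_apply M X (\<lambda>y. 0) x = 0"
  using chart_derivI(2)[of "chart_around M x" "\<lambda>y. 0 :: real" "\<lambda>_. 0"]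
  by (simp add: vf_apply_def in_chart_def o_def)

text \<open>The tangent and cotangent components are \<open>lie_bracket_twist\<close> and
  \<open>lie_deriv_twist\<close>. The components in u, v and \<alpha>(V) rest on the identity
  \<open>fn\<close>, the last one together with \<open>pairing_bracket\<close>.\<close>

lemma stable_courant_bracket_lift:
  assumes x: "x \<in> points M" and s: "big_section_on M h (points M) s1" "big_section_on M h (points M) s2"
    and w: "\<And>p. p < k \<Longrightarrow> smooth_function (w1 p)" "\<And>p. p < k \<Longrightarrow> smooth_function (w2 p)"
    and w0: "\<And>p. k \<le> p \<Longrightarrow> w1 p = (\<lambda>y. 0)" "\<And>p. k \<le> p \<Longrightarrow> w2 p = (\<lambda>y. 0)"
    and V: "\<And>p. p < k \<Longrightarrow> vector_field M (V p)"
    and comm: "\<And>p q. p < k \<Longrightarrow> q < k \<Longrightarrow> lie_bracket M (V p) (V q) x = 0"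
    and G: "\<And>p. p < k \<Longrightarrow> G_metric M h x (section_lie_deriv (V p) s1 x) (s2 x) = 0"
      "\<And>p. p < k \<Longrightarrow> G_metric M h x (section_lie_deriv (V p) s2 x) (s1 x) = 0"
  defines "T1 \<equiv> twist k V (\<lambda>y. tan_part (s1 y)) w1" and "T2 \<equiv> twist k V (\<lambda>y. tan_part (s2 y)) w2"
  shows "stable_courant_bracket M (h + k) (\<lambda>y. lift h k V y (s1 y) (\<lambda>p. w1 p y))
      (\<lambda>y. lift h k V y (s2 y) (\<lambda>p. w2 p y)) x
    = lift h k V x (stable_courant_bracket M h s1 s2 x
        + (\<Sum>p<k. w2 p x *\<^sub>R section_lie_deriv (V p) s1 x - w1 p x *\<^sub>R section_lie_deriv (V p) s2 x))
      (\<lambda>p. vf_apply M T1 (w2 p) x - vf_apply M T2 (w1 p) x)" (is "?B = lift h k V x ?s ?w")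
proof -
  let ?X1 = "\<lambda>y. tan_part (s1 y)" and ?X2 = "\<lambda>y. tan_part (s2 y)"
  let ?a1 = "\<lambda>y. cot_part (s1 y)" and ?a2 = "\<lambda>y. cot_part (s2 y)"
  let ?p1 = "\<lambda>p y. pairing M y (?a1 y) (V p y)" and ?p2 = "\<lambda>p y. pairing M y (?a2 y) (V p y)"
  note X = s[THEN big_section_onD(1)] and a = s[THEN big_section_onD(2)]
  note u = s[THEN big_section_onD(3)] and v = s[THEN big_section_onD(4)]
  have T: "vf_apply M T1 f x = vf_apply M ?X1 f x - (\<Sum>p<k. w1 p x * vf_apply M (V p) f x)"
    "vf_apply M T2 f x = vf_apply M ?X2 f x - (\<Sum>p<k. w2 p x * vf_apply M (V p) f x)"
    if "smooth_function f" for f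
    unfolding T1_def T2_def by (rule vf_apply_combination[OF x that])+
  \<comment> \<open>Splitting off the w.V parts of \<open>T1\<close> and \<open>T2\<close> produces
    derivatives along the V_p, which are the correction terms of s3.\<close>
  have fn: "vf_apply M T1 f2 x - vf_apply M T2 f1 x = vf_apply M ?X1 f2 x - vf_apply M ?X2 f1 x
      + (\<Sum>p<k. w2 p x * vf_apply M (V p) f1 x - w1 p x * vf_apply M (V p) f2 x)"
    if "smooth_function f1" "smooth_function f2" for f1 f2
    by (simp add: T that sum_subtractf)
  have tan_s: "tan_part ?s = lie_bracket M ?X1 ?X2 x
      + (\<Sum>p<k. w2 p x *\<^sub>R lie_bracket M (V p) ?X1 x - w1 p x *\<^sub>R lie_bracket M (V p) ?X2 x)"
    by (simp add: stable_courant_bracket_def Let_def section_lie_deriv_def fst_sum)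
  have u_s: "u_part ?s i = vf_apply M ?X1 (\<lambda>y. u_part (s2 y) i) x - vf_apply M ?X2 (\<lambda>y. u_part (s1 y) i) x
      + (\<Sum>p<k. w2 p x * vf_apply M (V p) (\<lambda>y. u_part (s1 y) i) x
          - w1 p x * vf_apply M (V p) (\<lambda>y. u_part (s2 y) i) x)" for i
    by (simp add: stable_courant_bracket_def Let_def section_lie_deriv_def fst_sum snd_sum
        sum_fun_apply scaleR_fun_apply)
  have v_s: "v_part ?s i = vf_apply M ?X1 (\<lambda>y. v_part (s2 y) i) x - vf_apply M ?X2 (\<lambda>y. v_part (s1 y) i) x
      + (\<Sum>p<k. w2 p x * vf_apply M (V p) (\<lambda>y. v_part (s1 y) i) x
          - w1 p x * vf_apply M (V p) (\<lambda>y. v_part (s2 y) i) x)" for i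
    by (simp add: stable_courant_bracket_def Let_def section_lie_deriv_def fst_sum snd_sum
        sum_fun_apply scaleR_fun_apply)
  have cot_s: "cot_part ?s = cot_part (stable_courant_bracket M h s1 s2 x)
      + (\<Sum>p<k. w2 p x *\<^sub>R lie_deriv M (V p) ?a1 x - w1 p x *\<^sub>R lie_deriv M (V p) ?a2 x)"
    by (simp add: section_lie_deriv_def fst_sum snd_sum)
  \<comment> \<open>Here commutativity removes \<alpha>([V_p,V_q]) from the derivative of
    \<alpha>(V_q) along V_p.\<close>
  have VV: "vf_apply M (V p) (\<lambda>y. pairing M y (\<alpha> y) (V q y)) x = pairing M x (lie_deriv M (V p) \<alpha> x) (V q x)"
    if "p < k" "q < k" "one_form \<alpha>" for p q \<alpha>
    using vf_apply_pairing[OF x V[OF that(1)] V[OF that(2)] that(3)] comm[OF that(1,2)]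
    by (simp add: pairing_linear)
  have pair: "vf_apply M T1 (?p2 q) x - vf_apply M T2 (?p1 q) x = pairing M x (cot_part ?s) (V q x)"
    if q: "q < k" for q
  proof -
    have "pairing M x (cot_part ?s) (V q x) = vf_apply M ?X1 (?p2 q) x - vf_apply M ?X2 (?p1 q) x
      + (\<Sum>p<k. w2 p x * pairing M x (lie_deriv M (V p) ?a1 x) (V q x)
          - w1 p x * pairing M x (lie_deriv M (V p) ?a2 x) (V q x))"
      unfolding cot_s pairing_linear pairing_bracket[OF x s V[OF q] G[OF q]] by (rule refl)
    also have "\<dots> = vf_apply M ?X1 (?p2 q) x - vf_apply M ?X2 (?p1 q) x
      + (\<Sum>p<k. w2 p x * vf_apply M (V p) (?p1 q) x - w1 p x * vf_apply M (V p) (?p2 q) x)"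
      using q a by (simp add: VV)
    finally show ?thesis
      using fn[OF smooth_pairing[OF a(1) V[OF q]] smooth_pairing[OF a(2) V[OF q]]] by simp
  qed
  have tan: "tan_part ?B = tan_part (lift h k V x ?s ?w)"
    using lie_bracket_twist[OF x X w V comm]
    unfolding stable_lift_def fst_conv snd_conv tan_s T1_def T2_def
    by (simp add: stable_courant_bracket_def Let_def)
  have cot: "cot_part ?B = cot_part (lift h k V x ?s ?w)"
  proof -
    \<comment> \<open>The sum over h + k indices splits; in the new block the u part is \<alpha>(V)
      and the v part is w, which is the situation of \<open>lie_deriv_twist\<close>.\<close>
    have "cot_part ?B = (lie_deriv M T1 ?a2 x - lie_deriv M T2 ?a1 x
      + (1/2) *\<^sub>R differential M (\<lambda>y. pairing M y (?a1 y) (T2 y) - pairing M y (?a2 y) (T1 y)) x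
      + (1/2) *\<^sub>R (\<Sum>p<k. ?p2 p x *\<^sub>R differential M (w1 p) x + w2 p x *\<^sub>R differential M (?p1 p) x
          - ?p1 p x *\<^sub>R differential M (w2 p) x - w1 p x *\<^sub>R differential M (?p2 p) x))
      + (1/2) *\<^sub>R (\<Sum>i<h. u_part (s2 x) i *\<^sub>R differential M (\<lambda>y. v_part (s1 y) i) x
          + v_part (s2 x) i *\<^sub>R differential M (\<lambda>y. u_part (s1 y) i) x
          - u_part (s1 x) i *\<^sub>R differential M (\<lambda>y. v_part (s2 y) i) x
          - v_part (s1 x) i *\<^sub>R differential M (\<lambda>y. u_part (s2 y) i) x)"
      by (simp add: stable_courant_bracket_def Let_def stable_lift_def vappend_def sum_lessThan_add
          scaleR_add_right T1_def T2_def)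
    also have "\<dots> = cot_part ?s"
      using lie_deriv_twist[of x ?X1 ?X2 ?a1 ?a2 k w1 w2 V, OF x X a w V]
      unfolding T1_def T2_def cot_s by (simp add: stable_courant_bracket_def Let_def)
    finally show ?thesis by (simp add: stable_lift_def)
  qed
  have up: "u_part ?B i = u_part (lift h k V x ?s ?w) i" for i
  proof -
    have B: "u_part ?B i = vf_apply M T1 (\<lambda>y. vappend h (u_part (s2 y)) (\<lambda>p. if p < k then ?p2 p y else 0) i) x
        - vf_apply M T2 (\<lambda>y. vappend h (u_part (s1 y)) (\<lambda>p. if p < k then ?p1 p y else 0) i) x"
      by (simp add: stable_courant_bracket_def Let_def stable_lift_def T1_def T2_def)
    \<comment> \<open>The index lies in the old block, in the block \<alpha>(V), or in the zero
      padding, where the derivatives of the constant 0 must vanish.\<close>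
    consider "i < h" | "h \<le> i" "i - h < k" | "h \<le> i" "\<not> i - h < k" by linarith
    then show ?thesis
    proof cases
      case 1
      then show ?thesis
        unfolding B using fn[OF u[OF 1]] u_s by (simp add: stable_lift_def vappend_def)
    next
      case 2
      then show ?thesis
        unfolding B using pair[OF 2(2)] by (simp add: stable_lift_def vappend_def)
    next
      case 3
      then show ?thesis
        unfolding B by (simp add: stable_lift_def vappend_def vf_apply_zero[OF x])
    qed
  qed
  have vp: "v_part ?B i = v_part (lift h k V x ?s ?w) i" for i
  proof -
    have B: "v_part ?B i = vf_apply M T1 (\<lambda>y. vappend h (v_part (s2 y)) (\<lambda>p. w2 p y) i) x
        - vf_apply M T2 (\<lambda>y. vappend h (v_part (s1 y)) (\<lambda>p. w1 p y) i) x"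
      by (simp add: stable_courant_bracket_def Let_def stable_lift_def T1_def T2_def)
    show ?thesis
    proof (cases "i < h")
      case True
      then show ?thesis
        unfolding B using fn[OF v[OF True]] v_s by (simp add: stable_lift_def vappend_def)
    next
      case False
      \<comment> \<open>From index \<open>h\<close> on the v part is w itself, so the bracket
        formula is literally w3.\<close>
      then show ?thesis
        unfolding B by (simp add: stable_lift_def vappend_def)
    qed
  qed
  show ?thesis
    by (intro prod_eqI ext) (use tan cot up vp in simp_all)
qed


section \<open>Sections of the lifted bundle\<close>

lemma vector_field_on_cong:
  assumes "openin (space_of M) W" "vector_field_on M W X" "\<And>x. x \<in> W \<Longrightarrow> X x = Y x"
  shows "vector_field_on M W Y"
  unfolding vector_field_on_def
proof (intro conjI ballI)
  show "Y x \<in> tangent_space M x" if "x \<in> W" for x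
    using assms(2) that unfolding vector_field_on_def assms(3)[OF that, symmetric] by blast
  show "smooth_on (snd c ` (fst c \<inter> W)) (in_chart c (\<lambda>x. Y x c))" if "c \<in> atlas M" for c
    by (rule smooth_in_chart_cong[OF that assms(1), of "\<lambda>x. X x c"])
      (use assms(2) that in \<open>simp add: vector_field_on_def\<close>, simp only: assms(3))
qed

lemma one_form_on_cong:
  assumes "openin (space_of M) W" "one_form_on M W \<alpha>" "\<And>x. x \<in> W \<Longrightarrow> \<alpha> x = \<beta> x"
  shows "one_form_on M W \<beta>"
  unfolding one_form_on_def
proof (intro conjI ballI)
  show "\<beta> x \<in> cotangent_space M x" if "x \<in> W" for x
    using assms(2) that unfolding one_form_on_def assms(3)[OF that, symmetric] by blast
  show "smooth_on (snd c ` (fst c \<inter> W)) (in_chart c (\<lambda>x. \<beta> x c))" if "c \<in> atlas M" for c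
    by (rule smooth_in_chart_cong[OF that assms(1), of "\<lambda>x. \<alpha> x c"])
      (use assms(2) that in \<open>simp add: one_form_on_def\<close>, simp only: assms(3))
qed

lemma big_section_on_cong:
  assumes W: "openin (space_of M) W" and s: "big_section_on M h W s" and eq: "\<And>x. x \<in> W \<Longrightarrow> s x = t x"
  shows "big_section_on M h W t"
proof -
  have "vector_field_on M W (\<lambda>x. tan_part (t x))"
    using big_section_onD(1)[OF s] by (rule vector_field_on_cong[OF W]) (simp add: eq)
  moreover have "one_form_on M W (\<lambda>x. cot_part (t x))"
    using big_section_onD(2)[OF s] by (rule one_form_on_cong[OF W]) (simp add: eq)
  moreover have "smooth_fun M W (\<lambda>x. u_part (t x) i)" "smooth_fun M W (\<lambda>x. v_part (t x) i)" if "i < h" for i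
    using eq by (auto intro: smooth_fun_cong[OF W big_section_onD(3)[OF s that]]
        smooth_fun_cong[OF W big_section_onD(4)[OF s that]])
  moreover have "t x \<in> big_fibre M h x" if "x \<in> W" for x
    using big_section_onD(5)[OF s that] eq[OF that] by simp
  ultimately show ?thesis by (simp add: big_section_on_def)
qed

section \<open>Sections as a module over the smooth functions\<close>

lemma big_section_on_add:
  assumes "openin (space_of M) W" "big_section_on M h W s" "big_section_on M h W t"
  shows "big_section_on M h W (\<lambda>x. s x + t x)"
  using assms by (simp add: big_section_on_def vector_field_on_add one_form_on_add smooth_fun_add
      subspace_add[OF subspace_big_fibre])

lemma big_section_on_scaleR:
  assumes "openin (space_of M) W" "smooth_fun M W f" "big_section_on M h W s"
  shows "big_section_on M h W (\<lambda>x. f x *\<^sub>R s x)"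
  using assms by (simp add: big_section_on_def vector_field_on_scaleR one_form_on_scaleR smooth_fun_mult
      subspace_scale[OF subspace_big_fibre] scaleR_fun_apply)

lemma big_section_on_zero: "openin (space_of M) W \<Longrightarrow> big_section_on M h W (\<lambda>x. 0)"
  by (simp add: big_section_on_def vector_field_on_zero one_form_on_zero smooth_fun_const
      subspace_0[OF subspace_big_fibre])

lemma sections_add:
  assumes "\<And>x. x \<in> points M \<Longrightarrow> subspace (L x)" "s \<in> sections_of M h L" "t \<in> sections_of M h L"
  shows "(\<lambda>x. s x + t x) \<in> sections_of M h L"
  using assms by (simp add: sections_of_def big_section_on_add subspace_add)

lemma sections_scaleR:
  assumes "\<And>x. x \<in> points M \<Longrightarrow> subspace (L x)" "smooth_function f" "s \<in> sections_of M h L"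
  shows "(\<lambda>x. f x *\<^sub>R s x) \<in> sections_of M h L"
  using assms by (simp add: sections_of_def big_section_on_scaleR subspace_scale)

lemma sections_sum:
  assumes L: "\<And>x. x \<in> points M \<Longrightarrow> subspace (L x)" and "\<And>i. i \<in> I \<Longrightarrow> s i \<in> sections_of M h L"
  shows "(\<lambda>x. \<Sum>i\<in>I. s i x) \<in> sections_of M h L"
proof -
  have 0: "(\<lambda>x. 0) \<in> sections_of M h L"
    using L by (simp add: sections_of_def big_section_on_zero subspace_0)
  show ?thesis
    using assms(2)
  proof (induction I rule: infinite_finite_induct)
    case (insert i I)
    have "(\<lambda>x. s i x + (\<Sum>i\<in>I. s i x)) \<in> sections_of M h L"
      using insert by (intro sections_add L) auto
    then show ?case
      by (simp only: sum.insert[OF insert(1,2)])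
  qed (use 0 in auto)
qed

lemma sections_diff:
  assumes L: "\<And>x. x \<in> points M \<Longrightarrow> subspace (L x)" and "s \<in> sections_of M h L" "t \<in> sections_of M h L"
  shows "(\<lambda>x. s x - t x) \<in> sections_of M h L"
  using sections_add[OF L assms(2) sections_scaleR[OF L smooth_fun_const[of "points M" "- 1"] assms(3)]]
  by simp

text \<open>Formulated over an open \<open>W\<close> because it serves twice: globally for brackets
  and on a neighbourhood for frames.\<close>

lemma big_section_on_lift:
  assumes W: "openin (space_of M) W" and s: "big_section_on M h W s"
    and w: "\<And>p. p < k \<Longrightarrow> smooth_fun M W (w p)" "\<And>p x. x \<in> W \<Longrightarrow> k \<le> p \<Longrightarrow> w p x = 0"
    and V: "\<And>p. p < k \<Longrightarrow> vector_field_on M W (V p)"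
  shows "big_section_on M (h + k) W (\<lambda>x. lift h k V x (s x) (\<lambda>p. w p x))"
proof -
  note sD = big_section_onD[OF s]
  have "lift h k V x (s x) (\<lambda>p. w p x) \<in> big_fibre M (h + k) x" if "x \<in> W" for x
    using that sD(5) w(2) V by (intro lift_big_fibre) (auto simp: Rvec_def vector_field_on_def)
  moreover have "vector_field_on M W (\<lambda>x. tan_part (lift h k V x (s x) (\<lambda>p. w p x)))"
    unfolding stable_lift_def fst_conv using sD(1) w(1) V
    by (intro vector_field_on_diff[OF W] vector_field_on_sum[OF W] vector_field_on_scaleR[OF W]) auto
  moreover have "one_form_on M W (\<lambda>x. cot_part (lift h k V x (s x) (\<lambda>p. w p x)))"
    using sD(2) by (simp add: stable_lift_def)
  moreover have "smooth_fun M W (\<lambda>x. u_part (lift h k V x (s x) (\<lambda>p. w p x)) i)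
      \<and> smooth_fun M W (\<lambda>x. v_part (lift h k V x (s x) (\<lambda>p. w p x)) i)" if "i < h + k" for i
  proof (cases "i < h")
    case True
    then show ?thesis using sD(3,4) by (simp add: stable_lift_def vappend_def)
  next
    case False
    then have "i - h < k" using that by simp
    then show ?thesis
      using False w(1) smooth_fun_pairing[OF W sD(2) V] by (simp add: stable_lift_def vappend_def)
  qed
  ultimately show ?thesis by (simp add: big_section_on_def)
qed

text \<open>T is undone by explicit smooth formulas, so the section of L and the functions w come
  out globally, without gluing local choices.\<close>

lemma section_unlift:
  assumes s: "s \<in> sections_of M (h + k) (stable_extension M h k V L)"
    and V: "\<And>p. p < k \<Longrightarrow> vector_field M (V p)"
    and L: "\<And>x. x \<in> points M \<Longrightarrow> L x \<subseteq> big_fibre M h x"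
  obtains t w where "t \<in> sections_of M h L" "\<And>p. p < k \<Longrightarrow> smooth_function (w p)"
    "\<And>p. k \<le> p \<Longrightarrow> w p = (\<lambda>y. 0)" "\<And>x. x \<in> points M \<Longrightarrow> s x = lift h k V x (t x) (\<lambda>p. w p x)"
proof -
  \<comment> \<open>The cut-off makes \<open>w p\<close> the zero function everywhere for
    \<open>p\<close> from \<open>k\<close> on, also outside \<open>points M\<close>, where
    membership says nothing about \<open>s\<close>.\<close>
  define w where "w = (\<lambda>p y. if p < k then v_part (s y) (h + p) else 0)"
  define t where "t = (\<lambda>y. ((tan_part (s y) + (\<Sum>p<k. w p y *\<^sub>R V p y),
      (\<lambda>i. if i < h then u_part (s y) i else 0)), (cot_part (s y), (\<lambda>i. if i < h then v_part (s y) i else 0))))"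
  have bs: "big_section_on M (h + k) (points M) s"
    using s by (simp add: sections_of_def)
  note sD = big_section_onD[OF bs]
  have smw: "smooth_function (w p)" if "p < k" for p
    using sD(4)[of "h + p"] that by (simp add: w_def)
  have pt: "t x \<in> L x \<and> s x = lift h k V x (t x) (\<lambda>p. w p x)" if x: "x \<in> points M" for x
  proof -
    have "s x \<in> stable_extension M h k V L x"
      using s x by (simp add: sections_of_def)
    then obtain a w' where aw: "a \<in> L x" "w' \<in> Rvec k" "s x = lift h k V x a w'"
      unfolding stable_extension_eq by blast
    have ww: "(\<lambda>p. w p x) = w'"
      using aw(2) by (auto simp: w_def aw(3) stable_lift_def vappend_def Rvec_def)
    then have wp: "w p x = w' p" for p by auto
    \<comment> \<open>\<open>t\<close> keeps only the first \<open>h\<close> entries; nothing is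
      lost, since elements of L_x have no others.\<close>
    have "u_part a i = 0 \<and> v_part a i = 0" if "h \<le> i" for i
      using L[OF x] aw(1) that by (auto simp: big_fibre_def Rvec_def)
    then have "t x = a"
      unfolding t_def aw(3) wp
      by (intro prod_eqI ext) (simp_all add: stable_lift_def vappend_def)
    then show ?thesis using aw ww by simp
  qed
  have "big_section_on M h (points M) t"
    unfolding big_section_on_def
  proof (intro conjI ballI allI impI)
    show "t x \<in> big_fibre M h x" if "x \<in> points M" for x
      using pt[OF that] L[OF that] by blast
    show "vector_field M (\<lambda>x. tan_part (t x))"
      unfolding t_def fst_conv using sD(1) smw V
      by (intro vector_field_on_add vector_field_on_sum vector_field_on_scaleR) auto
    show "one_form_on M (points M) (\<lambda>x. cot_part (t x))"
      using sD(2) by (simp add: t_def)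
    show "smooth_function (\<lambda>x. u_part (t x) i)" "smooth_function (\<lambda>x. v_part (t x) i)" if "i < h" for i
      using sD(3,4)[of i] that by (simp_all add: t_def)
  qed
  then have "t \<in> sections_of M h L"
    using pt by (simp add: sections_of_def)
  then show thesis
    using smw pt by (intro that[of t w]) (auto simp: w_def)
qed

section \<open>Closure of the extension under the bracket\<close>

lemma stable_courant_bracket_closed:
  assumes L: "stable_dirac M h L" and V: "\<And>p. p < k \<Longrightarrow> vector_field M (V p)"
    and comm: "\<And>p q x. p < k \<Longrightarrow> q < k \<Longrightarrow> x \<in> points M \<Longrightarrow> lie_bracket M (V p) (V q) x = 0"
    and aut: "\<And>p. p < k \<Longrightarrow> infinitesimal_automorphism M h L (V p)"
    and s: "s1 \<in> sections_of M (h + k) (stable_extension M h k V L)"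
      "s2 \<in> sections_of M (h + k) (stable_extension M h k V L)"
  shows "stable_courant_bracket M (h + k) s1 s2 \<in> sections_of M (h + k) (stable_extension M h k V L)"
proof -
  have iso: "maximal_isotropic M h x (L x)" if "x \<in> points M" for x
    using L that by (simp add: stable_dirac_def)
  then have sub: "subspace (L x)" "L x \<subseteq> big_fibre M h x" if "x \<in> points M" for x
    using that by (simp_all add: maximal_isotropic_def)
  obtain t1 w1 where t1: "t1 \<in> sections_of M h L" "\<And>p. p < k \<Longrightarrow> smooth_function (w1 p)"
    "\<And>p. k \<le> p \<Longrightarrow> w1 p = (\<lambda>y. 0)" "\<And>x. x \<in> points M \<Longrightarrow> s1 x = lift h k V x (t1 x) (\<lambda>p. w1 p x)"
    using section_unlift[OF s(1) V sub(2)] by blast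
  obtain t2 w2 where t2: "t2 \<in> sections_of M h L" "\<And>p. p < k \<Longrightarrow> smooth_function (w2 p)"
    "\<And>p. k \<le> p \<Longrightarrow> w2 p = (\<lambda>y. 0)" "\<And>x. x \<in> points M \<Longrightarrow> s2 x = lift h k V x (t2 x) (\<lambda>p. w2 p x)"
    using section_unlift[OF s(2) V sub(2)] by blast
  have bs: "big_section_on M h (points M) t1" "big_section_on M h (points M) t2"
    using t1(1) t2(1) by (simp_all add: sections_of_def)
  have D: "section_lie_deriv (V p) t \<in> sections_of M h L" if "p < k" "t \<in> sections_of M h L" for p t
    using aut[OF that(1)] that(2) unfolding infinitesimal_automorphism_def section_lie_deriv_def[abs_def] by blast
  \<comment> \<open>Combined with \<open>D\<close> this gives both conditions on G in the bracket
    formula, since the Lie derivative of a section along V_p is again a section of L.\<close>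
  have G: "G_metric M h x (t x) (t' x) = 0" if "t \<in> sections_of M h L" "t' \<in> sections_of M h L" "x \<in> points M" for t t' x
    using iso[OF that(3)] that by (simp add: maximal_isotropic_def isotropic_def sections_of_def)
  define T1 where "T1 = twist k V (\<lambda>y. tan_part (t1 y)) w1"
  define T2 where "T2 = twist k V (\<lambda>y. tan_part (t2 y)) w2"
  define t where "t = (\<lambda>x. stable_courant_bracket M h t1 t2 x
    + (\<Sum>p<k. w2 p x *\<^sub>R section_lie_deriv (V p) t1 x - w1 p x *\<^sub>R section_lie_deriv (V p) t2 x))"
  define w where "w = (\<lambda>p x. vf_apply M T1 (w2 p) x - vf_apply M T2 (w1 p) x)"
  have eq: "stable_courant_bracket M (h + k) s1 s2 x = lift h k V x (t x) (\<lambda>p. w p x)" if x: "x \<in> points M" for x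
  proof -
    have "stable_courant_bracket M (h + k) s1 s2 x
      = stable_courant_bracket M (h + k) (\<lambda>y. lift h k V y (t1 y) (\<lambda>p. w1 p y)) (\<lambda>y. lift h k V y (t2 y) (\<lambda>p. w2 p y)) x"
      by (rule stable_courant_bracket_cong[OF x t1(4) t2(4)])
    also have "\<dots> = lift h k V x (t x) (\<lambda>p. w p x)"
      unfolding t_def w_def T1_def T2_def
      using x by (intro stable_courant_bracket_lift bs t1 t2 V comm G D) auto
    finally show ?thesis .
  qed
  have "stable_courant_bracket M h t1 t2 \<in> sections_of M h L"
    using L t1(1) t2(1) by (simp add: stable_dirac_def)
  moreover have "(\<lambda>x. w2 p x *\<^sub>R section_lie_deriv (V p) t1 x - w1 p x *\<^sub>R section_lie_deriv (V p) t2 x)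
      \<in> sections_of M h L" if "p \<in> {..<k}" for p
    using that by (intro sections_diff sections_scaleR sub D t1 t2) auto
  ultimately have t: "t \<in> sections_of M h L"
    unfolding t_def by (intro sections_add sections_sum sub)
  have w: "smooth_function (w p)" if "p < k" for p
  proof -
    have "vector_field M T1" "vector_field M T2"
      unfolding T1_def T2_def using V t1(2) t2(2) bs[THEN big_section_onD(1)]
      by (auto intro!: vector_field_combination)
    then show ?thesis
      unfolding w_def using t1(2)[OF that] t2(2)[OF that]
      by (intro smooth_fun_diff smooth_fun_vf_apply) auto
  qed
  have w0: "w p x = 0" if "x \<in> points M" "k \<le> p" for p x
    using that by (simp add: w_def t1(3) t2(3) vf_apply_zero)
  have "big_section_on M (h + k) (points M) (\<lambda>x. lift h k V x (t x) (\<lambda>p. w p x))"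
    using t w w0 V by (intro big_section_on_lift) (auto simp: sections_of_def)
  \<comment> \<open>The bracket is identified with a lift on \<open>points M\<close> only, so
    smoothness is transferred by congruence.\<close>
  then have "big_section_on M (h + k) (points M) (stable_courant_bracket M (h + k) s1 s2)"
    by (rule big_section_on_cong[rotated]) (simp_all add: eq)
  moreover have "stable_courant_bracket M (h + k) s1 s2 x \<in> stable_extension M h k V L x" if "x \<in> points M" for x
  proof -
    have "t x \<in> L x" "(\<lambda>p. w p x) \<in> Rvec k"
      using t w0 that by (simp_all add: sections_of_def Rvec_def)
    then show ?thesis
      unfolding eq[OF that] stable_extension_eq by blast
  qed
  ultimately show ?thesis by (simp add: sections_of_def)
qed

section \<open>Smooth local frames of the extension\<close>

text \<open>Freezing one argument at 0 makes T a linear map of the other, so sums and spans can be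
  pushed through it.\<close>

lemma linear_lift_left: "linear (\<lambda>a. lift h k V x a 0)"
proof (rule linearI)
  show "lift h k V x (a + b) 0 = lift h k V x a 0 + lift h k V x b 0" for a b
    using lift_add[of h k V x a b 0 0] unfolding add_0_right .
  show "lift h k V x (r *\<^sub>R a) 0 = r *\<^sub>R lift h k V x a 0" for r a
    using lift_scaleR[of h k V x r a 0] unfolding scaleR_zero_right .
qed

lemma linear_lift_right: "linear (\<lambda>w. lift h k V x 0 w)"
proof (rule linearI)
  show "lift h k V x 0 (w + w') = lift h k V x 0 w + lift h k V x 0 w'" for w w'
    using lift_add[of h k V x 0 0 w w'] unfolding add_0_right .
  show "lift h k V x 0 (r *\<^sub>R w) = r *\<^sub>R lift h k V x 0 w" for r w
    using lift_scaleR[of h k V x r 0 w] unfolding scaleR_zero_right .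
qed

lemma lift_split: "lift h k V x a w = lift h k V x a 0 + lift h k V x 0 w"
  using lift_add[of h k V x a 0 0 w] unfolding add_0_right add_0_left .

text \<open>A local frame e of L gives the local frame T(e_i,0), T(0,e_p) of the extension, so the
  rank grows by \<open>k\<close>.\<close>

lemma smooth_subbundle_extension:
  assumes L: "smooth_subbundle M h r L" and V: "\<And>p. p < k \<Longrightarrow> vector_field M (V p)"
  shows "smooth_subbundle M (h + k) (r + k) (stable_extension M h k V L)"
  unfolding smooth_subbundle_def
proof (intro conjI ballI)
  fix x assume x: "x \<in> points M"
  have Lx: "subspace (L x)" "L x \<subseteq> big_fibre M h x"
    using L x by (simp_all add: smooth_subbundle_def)
  show "subspace (stable_extension M h k V L x)"
    unfolding stable_extension_eq by (rule subspace_lift[OF Lx(1)])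
  show "stable_extension M h k V L x \<subseteq> big_fibre M (h + k) x"
    using Lx(2) vector_fieldD[OF V x] by (auto simp: stable_extension_eq intro!: lift_big_fibre)
next
  fix x assume x: "x \<in> points M"
  have "\<exists>W e. openin (space_of M) W \<and> x \<in> W \<and> (\<forall>i<r. big_section_on M h W (e i)) \<and>
      (\<forall>y\<in>W. inj_on (\<lambda>i. e i y) {..<r} \<and> independent ((\<lambda>i. e i y) ` {..<r}) \<and>
        span ((\<lambda>i. e i y) ` {..<r}) = L y)"
    using L x unfolding smooth_subbundle_def by blast
  then obtain W e where W: "openin (space_of M) W" "x \<in> W"
    and e: "\<And>i. i < r \<Longrightarrow> big_section_on M h W (e i)"
    and ind: "\<And>y. y \<in> W \<Longrightarrow> inj_on (\<lambda>i. e i y) {..<r} \<and> independent ((\<lambda>i. e i y) ` {..<r})"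
    and spn: "\<And>y. y \<in> W \<Longrightarrow> span ((\<lambda>i. e i y) ` {..<r}) = L y"
    by blast
  \<comment> \<open>Indices below \<open>r\<close> carry the lifted frame of L, the \<open>k\<close>
    indices from \<open>r\<close> on the lifted unit vectors.\<close>
  define e' where "e' = (\<lambda>i y. if i < r then lift h k V y (e i y) 0 else lift h k V y 0 (unit_vec (i - r)))"
  have VW: "vector_field_on M W (V p)" if "p < k" for p
    using V[OF that] openin_subset[OF W(1)] by (rule vector_field_on_subset)
  \<comment> \<open>Every combination of the new frame is T of a pair of combinations. Injectivity
    of T then splits a linear relation into one for e and one for the unit vectors.\<close>
  have comb: "(\<Sum>i<r + k. c i *\<^sub>R e' i y)
      = lift h k V y (\<Sum>i<r. c i *\<^sub>R e i y) (\<Sum>p<k. c (r + p) *\<^sub>R unit_vec p)" for c y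
  proof -
    have "(\<Sum>i<r + k. c i *\<^sub>R e' i y) = (\<Sum>i<r. c i *\<^sub>R lift h k V y (e i y) 0)
        + (\<Sum>p<k. c (r + p) *\<^sub>R lift h k V y 0 (unit_vec p))"
      by (simp add: sum_lessThan_add e'_def)
    also have "(\<Sum>i<r. c i *\<^sub>R lift h k V y (e i y) 0) = lift h k V y (\<Sum>i<r. c i *\<^sub>R e i y) 0"
      unfolding linear_sum[OF linear_lift_left] linear_cmul[OF linear_lift_left] by (rule refl)
    also have "(\<Sum>p<k. c (r + p) *\<^sub>R lift h k V y 0 (unit_vec p))
        = lift h k V y 0 (\<Sum>p<k. c (r + p) *\<^sub>R unit_vec p)"
      unfolding linear_sum[OF linear_lift_right] linear_cmul[OF linear_lift_right] by (rule refl)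
    finally show ?thesis
      unfolding lift_split[symmetric] .
  qed
  have sections: "big_section_on M (h + k) W (e' i)" if i: "i < r + k" for i
    proof (cases "i < r")
      case True
      then show ?thesis
        using big_section_on_lift[OF W(1) e[OF True], of k "\<lambda>p x. 0" V] VW
        by (simp add: e'_def zero_fun_def smooth_fun_const[OF W(1)])
    next
      case False
      then show ?thesis
        using big_section_on_lift[OF W(1) big_section_on_zero[OF W(1)], of k "\<lambda>p x. unit_vec (i - r) p" V]
          VW i
        by (simp add: e'_def unit_vec_def smooth_fun_const[OF W(1)])
    qed
  have Ly: "subspace (L y)" "L y \<subseteq> big_fibre M h y" if "y \<in> W" for y
    using L that openin_subset[OF W(1)] by (auto simp: smooth_subbundle_def)
  have indep: "inj_on (\<lambda>i. e' i y) {..<r + k} \<and> independent ((\<lambda>i. e' i y) ` {..<r + k})"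
    if y: "y \<in> W" for y
    unfolding independent_family_iff[OF finite_lessThan]
  proof (intro allI impI)
    fix c assume c: "(\<Sum>i<r + k. c i *\<^sub>R e' i y) = 0"
    show "\<forall>i\<in>{..<r + k}. c i = 0"
    proof -
      let ?a = "\<Sum>i<r. c i *\<^sub>R e i y" and ?w = "\<Sum>p<k. c (r + p) *\<^sub>R unit_vec p"
      have "?a \<in> big_fibre M h y"
        using y big_section_onD(5)[OF e]
        by (intro subspace_sum[OF subspace_big_fibre] subspace_scale[OF subspace_big_fibre]) auto
      then have aw: "?a = 0" "?w = 0"
        using lift_eq_zero c unfolding comb by blast+
      have "\<forall>i\<in>{..<r}. c i = 0"
        using aw(1) ind[OF y] independent_family_iff[of "{..<r}" "\<lambda>i. e i y"] by simp
      moreover have "c (r + p) = 0" if "p < k" for p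
        using fun_cong[OF aw(2), of p] that
        by (simp add: sum_fun_apply scaleR_fun_apply unit_vec_def if_distrib[of "\<lambda>t. _ * t"] cong: if_cong)
      ultimately show ?thesis
        by (metis add_diff_inverse_nat lessThan_iff nat_add_left_cancel_less)
    qed
  qed
  have spans: "span ((\<lambda>i. e' i y) ` {..<r + k}) = stable_extension M h k V L y" (is "span ?E = ?X")
    if y: "y \<in> W" for y
    proof
      have "e' i y \<in> ?X" if "i < r + k" for i
      proof (cases "i < r")
        case True
        then have "e i y \<in> (\<lambda>i. e i y) ` {..<r}"
          by simp
        then have "e i y \<in> L y"
          unfolding spn[OF y, symmetric] by (rule span_base)
        then show ?thesis
          unfolding e'_def stable_extension_eq if_P[OF True] using subspace_0[OF subspace_Rvec] by blast
      next
        case False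
        then have "unit_vec (i - r) \<in> Rvec k"
          using that by (intro unit_vec_Rvec) simp
        then show ?thesis
          unfolding e'_def stable_extension_eq if_not_P[OF False] using subspace_0[OF Ly(1)[OF y]] by blast
      qed
      then show "span ?E \<subseteq> ?X"
        unfolding stable_extension_eq by (intro span_minimal subspace_lift[OF Ly(1)[OF y]]) auto
      have lift0: "lift h k V y a 0 \<in> span ?E" if "a \<in> L y" for a
      proof -
        have "lift h k V y a 0 \<in> span ((\<lambda>a. lift h k V y a 0) ` (\<lambda>i. e i y) ` {..<r})"
          using that unfolding linear_span_image[OF linear_lift_left] spn[OF y] by blast
        also have "\<dots> \<subseteq> span ?E"
        proof (rule span_mono)
          have "lift h k V y (e i y) 0 = e' i y" if "i < r" for i
            using that by (simp add: e'_def)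
          then show "(\<lambda>a. lift h k V y a 0) ` (\<lambda>i. e i y) ` {..<r} \<subseteq> ?E"
            by auto
        qed
        finally show ?thesis .
      qed
      have unit: "lift h k V y 0 (unit_vec p) \<in> span ?E" if "p < k" for p
        using that by (intro span_base image_eqI[of _ _ "r + p"]) (auto simp: e'_def)
      show "?X \<subseteq> span ?E"
      proof
        fix b assume "b \<in> ?X"
        then obtain a w where aw: "a \<in> L y" "w \<in> Rvec k" "b = lift h k V y a w"
          unfolding stable_extension_eq by blast
        have "b = lift h k V y a 0 + lift h k V y 0 (\<Sum>p<k. w p *\<^sub>R unit_vec p)"
          unfolding aw(3) Rvec_expansion[OF aw(2), symmetric] by (rule lift_split)
        also have "lift h k V y 0 (\<Sum>p<k. w p *\<^sub>R unit_vec p) = (\<Sum>p<k. w p *\<^sub>R lift h k V y 0 (unit_vec p))"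
          unfolding linear_sum[OF linear_lift_right] linear_cmul[OF linear_lift_right] by (rule refl)
        finally have "b = lift h k V y a 0 + (\<Sum>p<k. w p *\<^sub>R lift h k V y 0 (unit_vec p))" .
        then show "b \<in> span ?E"
          using lift0[OF aw(1)] unit by (auto intro!: span_add span_sum span_scale)
      qed
    qed
  show "\<exists>W e. openin (space_of M) W \<and> x \<in> W \<and> (\<forall>i<r + k. big_section_on M (h + k) W (e i)) \<and>
      (\<forall>y\<in>W. inj_on (\<lambda>i. e i y) {..<r + k} \<and> independent ((\<lambda>i. e i y) ` {..<r + k}) \<and>
        span ((\<lambda>i. e i y) ` {..<r + k}) = stable_extension M h k V L y)"
    by (rule exI[of _ W], rule exI[of _ e']) (simp add: W sections indep spans)
qed

end

theorem theorem2p1: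
  fixes M :: "('m, 'e::real_inner) manifold"
    and h k :: nat
    and L :: "'m \<Rightarrow> ('m, 'e) big set"
    and V :: "nat \<Rightarrow> 'm \<Rightarrow> ('m, 'e) tvec"
  assumes "smooth_manifold M"
    and "k \<ge> 1"
    and "stable_dirac M h L"
    and "\<And>p. p < k \<Longrightarrow> vector_field M (V p)"
    and "\<And>p q x. p < k \<Longrightarrow> q < k \<Longrightarrow> x \<in> points M \<Longrightarrow> lie_bracket M (V p) (V q) x = 0"
    and "\<And>p. p < k \<Longrightarrow> infinitesimal_automorphism M h L (V p)"
  shows "stable_dirac M (h + k) (stable_extension M h k V L)"
proof -
  interpret smooth_mfd M
    using assms(1) by unfold_locales
  show ?thesis
    unfolding stable_dirac_def
  proof (intro conjI ballI)
    show "smooth_subbundle M (h + k) (dim (UNIV :: 'e set) + (h + k)) (stable_extension M h k V L)"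
      \<comment> \<open>For r = dim M + h the rank r + k is the one demanded at index h + k.\<close>
      using smooth_subbundle_extension[OF _ assms(4), of h "dim (UNIV :: 'e set) + h" L k] assms(3)
      by (simp add: stable_dirac_def add.assoc)
    show "maximal_isotropic M (h + k) x (stable_extension M h k V L x)" if "x \<in> points M" for x
      unfolding stable_extension_eq
      using assms(3) that by (intro maximal_isotropic_lift vector_fieldD assms(4)) (auto simp: stable_dirac_def)
    show "stable_courant_bracket M (h + k) s1 s2 \<in> sections_of M (h + k) (stable_extension M h k V L)"
      if "s1 \<in> sections_of M (h + k) (stable_extension M h k V L)"
        "s2 \<in> sections_of M (h + k) (stable_extension M h k V L)" for s1 s2
      by (rule stable_courant_bracket_closed[OF assms(3-6) that])
  qed
qed

end
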